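(* Assume that $P_i\succ0$ ($n\times n$), $\alpha_i\ge0$, $\gamma_i>0$, $\boldsymbol L_i\in\mathbb R^{m\times n}$ ($i\in\mathcal I$) and $\boldsymbol Q\succ0$ ($n\times n$) satisfy, for all $i\in\mathcal I$, $$\begin{bmatrix}\boldsymbol Q^{-1}&0&P_i^{-1}&0&0 \\ 0&\boldsymbol P_{-i}^{-1}&(\mathbf 1_{N-1}\otimes I_n)P_i^{-1}&0&0 \\ P_i^{-1}&P_i^{-1}(\mathbf 1_{N-1}\otimes I_n)^\top&(N-1)P_i^{-1}&-\gamma_i^{-1}P_i^{-1}&-\boldsymbol L_i^\top \\ 0&0&-\gamma_i^{-1}P_i^{-1}&0&0 \\ 0&0&-\boldsymbol L_i&0&0\end{bmatrix}-\alpha_i\,\Gamma_i\,\Phi^i\,\Gamma_i^\top\succcurlyeq0,\qquad\Gamma_i:=\begin{bmatrix} 0&0 \\ 0&0 \\ I&\dot X_i \\ 0&-X_i \\ 0&-U_i\end{bmatrix}.$$ Then the controller $$\sigma(x)=\min\{\operatorname{argmin}_{i\in\mathcal I}x^\top P_ix\},\qquad u(x)=K_{\sigma(x)}x,\qquad K_i:=\gamma_i\boldsymbol L_iP_i,$$ globally asymptotically stabilizes (at the origin) the switched system $\dot x=\bar A_\sigma x+\bar B_\sigma u$. Furthermore, with $Q:=\boldsymbol Q\,\min_{i\in\mathcal I}\gamma_i$, every closed-loop solution satisfies $$\int_0^\infty x(t)^\top Qx(t)\,dt\le\min_{i\in\mathcal I}x(0)^\top P_ix(0).$$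
   Context: Let $\mathcal I=\{1,\dots,N\}$. For each $i\in\mathcal I$, true (unknown) matrices $\bar A_i\in\mathbb R^{n\times n}$, $\bar B_i\in\mathbb R^{n\times m}$ are given, together with data matrices $X_i,\dot X_i\in\mathbb R^{n\times T_i}$, $U_i\in\mathbb R^{m\times T_i}$ (here $\dot X_i$ is just a name) satisfying $\dot X_i=\bar A_iX_i+\bar B_iU_i+\bar W_i$ for an unknown $\bar W_i\in\mathcal W_i$, where $$\mathcal W_i:=\Big\{W\in\mathbb R^{n\times T_i}\ \Big|\ \begin{bmatrix} I \\ W^\top\end{bmatrix}^\top\Phi^i\begin{bmatrix} I \\ W^\top\end{bmatrix}\succcurlyeq 0\Big\},\qquad \Phi^i=\begin{bmatrix}\Phi^i_{1,1}&\Phi^i_{1,2} \\ {\Phi^i_{1,2}}^\top&\Phi^i_{2,2}\end{bmatrix}$$ with known symmetric $\Phi^i$ and $\Phi^i_{2,2}\prec0$ ($\Phi^i_{1,1}$ is $n\times n$, $\Phi^i_{2,2}$ is $T_i\times T_i$). $\boldsymbol P_{-i}:=\mathrm{diag}((P_j)_{j\in\mathcal I\setminus\{i\}})$ (block diagonal); $\mathbf 1_{N-1}$ is the all-ones vector. The row blocks of $\Gamma_i$ have heights $n,(N-1)n,n,n,m$ and its column blocks have widths $n,T_i$. Solution concept. Put $\xi_i(x):=(\bar A_i+\bar B_iK_i)x$, $\mathcal X_i:=\{x\in\mathbb R^n\mid\sigma(x)=i\}$, $\mathrm I(x):=\{i\in\mathcal I\mid$ every neighborhood of $x$ meets $\mathcal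 X_i\}$, and $\dot v_i(x,\xi):=x^\top P_i\xi+\xi^\top P_ix$. A solution of the closed-loop system is an absolutely continuous $x:\mathbb R_{\ge0}\to\mathbb R^n$ such that for almost all $t$ there are weights $\alpha_i\ge0$ ($i\in\mathrm I(x(t))$) with $\sum_{i\in\mathrm I(x(t))}\alpha_i=1$ (unrelated to the scalars $\alpha_i$ in the matrix inequality), for which, with $x=x(t)$, $$\dot x(t)=\sum_{i\in\mathrm I(x)}\alpha_i\xi_i(x)\quad\text{and}\quad \dot v_{\sigma(x)}\Big(x,\sum_{i\in\mathrm I(x)}\alpha_i\xi_i(x)\Big)\le\sum_{i\in\mathrm I(x)}\dot v_i(x,\alpha_i\xi_i(x)).$$ Existence of solutions in this sense is assumed wherever needed. Global asymptotic stability of the origin means that the origin is Lyapunov stable with respect to all such solutions and every such solution converges to $0$ as $t\to\infty$. *)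

theory Defs
  imports "HOL-Analysis.Analysis" "Jordan_Normal_Form.Gauss_Jordan_Elimination"
begin

hide_type (open) Finite_Cartesian_Product.vec
hide_const (open) Finite_Cartesian_Product.vec Finite_Cartesian_Product.mat
unbundle no inner_syntax
unbundle no vec_syntax

text \<open>
  The widths \<open>T i\<close> of the data matrices vary with \<open>i\<close>, so all matrices and vectors are those of
  \<^theory>\<open>Jordan_Normal_Form.Matrix\<close>, with explicit dimensions. The Euclidean space of dimension
  \<open>n\<close> is \<open>carrier_vec n\<close>; that vector type carries no topology, whence the definitions of norm,
  derivative and absolute continuity below.
\<close>

subsection \<open>Matrices\<close>

definition pos_semidef :: "real mat \<Rightarrow> bool" where
  "pos_semidef A \<longleftrightarrow> square_mat A \<and> transpose_mat A = A \<and>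
     (\<forall>v \<in> carrier_vec (dim_row A). 0 \<le> v \<bullet> (A *\<^sub>v v))"

definition pos_def :: "real mat \<Rightarrow> bool" where
  "pos_def A \<longleftrightarrow> square_mat A \<and> transpose_mat A = A \<and>
     (\<forall>v \<in> carrier_vec (dim_row A). v \<noteq> 0\<^sub>v (dim_row A) \<longrightarrow> 0 < v \<bullet> (A *\<^sub>v v))"

text \<open>Meaningful for invertible matrices only; otherwise \<^const>\<open>mat_inverse\<close> yields \<^const>\<open>None\<close>.\<close>

definition minv :: "real mat \<Rightarrow> real mat" where
  "minv A = the (mat_inverse A)"

definition append_cols :: "real mat \<Rightarrow> real mat \<Rightarrow> real mat" (infixr \<open>@\<^sub>c\<close> 66) where
  "A @\<^sub>c B = four_block_mat A B (0\<^sub>m 0 (dim_col A)) (0\<^sub>m 0 (dim_col B))"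

definition kronecker :: "real mat \<Rightarrow> real mat \<Rightarrow> real mat" (infixl \<open>\<otimes>\<^sub>K\<close> 70) where
  "A \<otimes>\<^sub>K B = mat (dim_row A * dim_row B) (dim_col A * dim_col B)
     (\<lambda>(r, c). A $$ (r div dim_row B, c div dim_col B) * B $$ (r mod dim_row B, c mod dim_col B))"

definition ones_col :: "nat \<Rightarrow> real mat" where
  "ones_col k = mat k 1 (\<lambda>_. 1)"

subsection \<open>Data and matrix inequality\<close>

definition noise_set :: "nat \<Rightarrow> nat \<Rightarrow> real mat \<Rightarrow> real mat set" where
  "noise_set n T \<Phi> = {W \<in> carrier_mat n T.
     pos_semidef (transpose_mat (1\<^sub>m n @\<^sub>r transpose_mat W) * \<Phi> * (1\<^sub>m n @\<^sub>r transpose_mat W))}"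

definition diag_others :: "nat \<Rightarrow> (nat \<Rightarrow> real mat) \<Rightarrow> nat \<Rightarrow> real mat" where
  "diag_others N P i = diag_block_mat (map P (filter (\<lambda>j. j \<noteq> i) [1..<Suc N]))"

definition design_mat ::
  "nat \<Rightarrow> nat \<Rightarrow> nat \<Rightarrow> (nat \<Rightarrow> real mat) \<Rightarrow> real mat \<Rightarrow> (nat \<Rightarrow> real) \<Rightarrow> (nat \<Rightarrow> real mat) \<Rightarrow> nat \<Rightarrow> real mat"
where
  "design_mat n m N P Q \<gamma> L i =
    (let k = (N - 1) * n; R = minv (P i); E = ones_col (N - 1) \<otimes>\<^sub>K 1\<^sub>m n;
         S = - (inverse (\<gamma> i) \<cdot>\<^sub>m R)
     in (minv Q   @\<^sub>c 0\<^sub>m n k                    @\<^sub>c R                         @\<^sub>c 0\<^sub>m n n @\<^sub>c 0\<^sub>m n m) @\<^sub>r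
        (0\<^sub>m k n  @\<^sub>c minv (diag_others N P i) @\<^sub>c E * R                     @\<^sub>c 0\<^sub>m k n @\<^sub>c 0\<^sub>m k m) @\<^sub>r
        (R        @\<^sub>c R * transpose_mat E      @\<^sub>c real (N - 1) \<cdot>\<^sub>m R @\<^sub>c S      @\<^sub>c - transpose_mat (L i)) @\<^sub>r
        (0\<^sub>m n n  @\<^sub>c 0\<^sub>m n k                    @\<^sub>c S                         @\<^sub>c 0\<^sub>m n n @\<^sub>c 0\<^sub>m n m) @\<^sub>r
        (0\<^sub>m m n  @\<^sub>c 0\<^sub>m m k                    @\<^sub>c - L i                     @\<^sub>c 0\<^sub>m m n @\<^sub>c 0\<^sub>m m m))"

definition data_mat :: "nat \<Rightarrow> nat \<Rightarrow> nat \<Rightarrow> nat \<Rightarrow> real mat \<Rightarrow> real mat \<Rightarrow> real mat \<Rightarrow> real mat" where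
  "data_mat n m N T Xd X U =
    (let k = (N - 1) * n
     in (0\<^sub>m n n @\<^sub>c 0\<^sub>m n T) @\<^sub>r
        (0\<^sub>m k n @\<^sub>c 0\<^sub>m k T) @\<^sub>r
        (1\<^sub>m n   @\<^sub>c Xd)     @\<^sub>r
        (0\<^sub>m n n @\<^sub>c - X)    @\<^sub>r
        (0\<^sub>m m n @\<^sub>c - U))"

subsection \<open>Curves in Euclidean space\<close>

definition eucl_norm :: "real vec \<Rightarrow> real" where
  "eucl_norm v = sqrt (v \<bullet> v)"

definition abs_cont_on :: "real set \<Rightarrow> (real \<Rightarrow> real vec) \<Rightarrow> bool" where
  "abs_cont_on S x \<longleftrightarrow> (\<forall>\<epsilon>>0. \<exists>\<delta>>0. \<forall>D.
     finite D \<and> (\<forall>(a, b) \<in> D. a \<in> S \<and> b \<in> S \<and> a \<le> b) \<and>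
     pairwise (\<lambda>(a, b) (c, d). {a<..<b} \<inter> {c<..<d} = {}) D \<and>
     (\<Sum>(a, b)\<in>D. b - a) < \<delta> \<longrightarrow>
     (\<Sum>(a, b)\<in>D. eucl_norm (x b - x a)) < \<epsilon>)"

definition has_vec_deriv :: "(real \<Rightarrow> real vec) \<Rightarrow> real vec \<Rightarrow> real filter \<Rightarrow> bool" where
  "has_vec_deriv x d F \<longleftrightarrow> (\<forall>k < dim_vec d. ((\<lambda>t. x t $ k) has_field_derivative d $ k) F)"

subsection \<open>Closed loop\<close>

definition switching :: "nat \<Rightarrow> (nat \<Rightarrow> real mat) \<Rightarrow> real vec \<Rightarrow> nat" where
  "switching N P x = Min {i. is_arg_min (\<lambda>i. x \<bullet> (P i *\<^sub>v x)) (\<lambda>i. i \<in> {1..N}) i}"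

definition gain :: "(nat \<Rightarrow> real) \<Rightarrow> (nat \<Rightarrow> real mat) \<Rightarrow> (nat \<Rightarrow> real mat) \<Rightarrow> nat \<Rightarrow> real mat" where
  "gain \<gamma> L P i = \<gamma> i \<cdot>\<^sub>m (L i * P i)"

definition mode_field ::
  "(nat \<Rightarrow> real mat) \<Rightarrow> (nat \<Rightarrow> real mat) \<Rightarrow> (nat \<Rightarrow> real mat) \<Rightarrow> nat \<Rightarrow> real vec \<Rightarrow> real vec" where
  "mode_field A B K i x = (A i + B i * K i) *\<^sub>v x"

definition active_modes :: "nat \<Rightarrow> nat \<Rightarrow> (real vec \<Rightarrow> nat) \<Rightarrow> real vec \<Rightarrow> nat set" where
  "active_modes n N \<sigma> x =
     {i \<in> {1..N}. \<forall>\<epsilon>>0. \<exists>y \<in> carrier_vec n. eucl_norm (y - x) < \<epsilon> \<and> \<sigma> y = i}"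

definition vdot :: "real mat \<Rightarrow> real vec \<Rightarrow> real vec \<Rightarrow> real" where
  "vdot P x \<xi> = x \<bullet> (P *\<^sub>v \<xi>) + \<xi> \<bullet> (P *\<^sub>v x)"

text \<open>
  Absolute continuity on the half-line is understood on every compact subinterval, the usual
  convention for solutions of differential inclusions.
\<close>

definition closed_loop_solutions ::
  "nat \<Rightarrow> nat \<Rightarrow> (nat \<Rightarrow> real mat) \<Rightarrow> (nat \<Rightarrow> real mat) \<Rightarrow> (nat \<Rightarrow> real mat) \<Rightarrow> (nat \<Rightarrow> real mat) \<Rightarrow>
   (real vec \<Rightarrow> nat) \<Rightarrow> (real \<Rightarrow> real vec) set" where
  "closed_loop_solutions n N A B P K \<sigma> = {x.
     (\<forall>t\<ge>0. x t \<in> carrier_vec n) \<and>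
     (\<forall>c\<ge>0. abs_cont_on {0..c} x) \<and>
     (AE t in lebesgue. 0 \<le> t \<longrightarrow>
       (\<exists>w :: nat \<Rightarrow> real.
          let J = active_modes n N \<sigma> (x t);
              \<xi> = (\<lambda>i. mode_field A B K i (x t));
              d = finsum_vec TYPE(real) n (\<lambda>i. w i \<cdot>\<^sub>v \<xi> i) J
          in (\<forall>i\<in>J. 0 \<le> w i) \<and> (\<Sum>i\<in>J. w i) = 1 \<and>
             has_vec_deriv x d (at t within {0..}) \<and>
             vdot (P (\<sigma> (x t))) (x t) d \<le> (\<Sum>i\<in>J. vdot (P i) (x t) (w i \<cdot>\<^sub>v \<xi> i))))}"

definition globally_asymptotically_stable :: "(real \<Rightarrow> real vec) set \<Rightarrow> bool" where
  "globally_asymptotically_stable sols \<longleftrightarrow>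
     (\<forall>\<epsilon>>0. \<exists>\<delta>>0. \<forall>x\<in>sols. eucl_norm (x 0) < \<delta> \<longrightarrow> (\<forall>t\<ge>0. eucl_norm (x t) < \<epsilon>)) \<and>
     (\<forall>x\<in>sols. ((\<lambda>t. eucl_norm (x t)) \<longlongrightarrow> 0) at_top)"

end

theory Submission
  imports Defs "Jordan_Normal_Form.Determinant"
begin

text \<open>
  Testing the matrix inequality for mode \<open>i\<close> with a suitable vector, the noise bound on the data gives
  \<open>2 x\<^sup>T P\<^sub>i (A\<^sub>i + B\<^sub>i K\<^sub>i) x \<le> -\<gamma>\<^sub>i (x\<^sup>T Q x + (\<Sum>j\<noteq>i. x\<^sup>T P\<^sub>j x - x\<^sup>T P\<^sub>i x))\<close>, and by continuity every active
  mode minimizes \<open>x\<^sup>T P\<^sub>i x\<close>, so that the sum is nonnegative there. Hence the Lyapunov function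
  \<open>V x = min\<^sub>i x\<^sup>T P\<^sub>i x\<close> decreases along solutions at the rate \<open>x\<^sup>T Q x\<close> times the least \<open>\<gamma>\<^sub>i\<close>. Since \<open>V\<close> is
  only absolutely continuous along a solution, this is integrated through a monotonicity criterion for
  absolutely continuous functions in terms of the upper right Dini derivative. The cost bound follows at
  once, and since \<open>V\<close> is nonincreasing and its integral is bounded, \<open>V (x t) = O(1/t)\<close>.
\<close>

text \<open>The matrices \<open>A i\<close> and \<open>B i\<close> are unknown, yet they may enter
  the test vector, since the matrix inequality is only evaluated there. Apart from the data term its
  lower right corner is zero, so the form is affine in the last two blocks; taking
  \<open>A^T P_i x\<close> and \<open>B^T P_i x\<close> for them turns the affine terms into the
  derivative along mode \<open>i\<close> and makes the data equation collapse to the noise. The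
  first two blocks carry the inverses of \<open>Qb\<close> and of the other \<open>P j\<close>, and
  eliminating them brings these matrices back without inverses. What results concerns
  \<open>P i\<close> along the field of mode \<open>i\<close> alone. On a switching surface a
  solution moves along a mixture of fields, and nothing is known about the selected form along the
  field of another mode. The second condition of the solution concept closes this gap. Each mode
  comes with its own factor \<gamma> i, and only the least of them holds for all mixtures; hence the
  minimum in the cost.\<close>

section \<open>Absolutely continuous real functions\<close>

text \<open>The quantification over interval families is that of \<open>abs_cont_on\<close>, so that
  a family admissible for a vector curve is admissible for any scalar function whose increments the
  curve controls.\<close>

definition abs_cont_real :: "real set \<Rightarrow> (real \<Rightarrow> real) \<Rightarrow> bool" where
  "abs_cont_real S f \<longleftrightarrow> (\<forall>\<epsilon>>0. \<exists>\<delta>>0. \<forall>D.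
     finite D \<and> (\<forall>(a, b) \<in> D. a \<in> S \<and> b \<in> S \<and> a \<le> b) \<and>
     pairwise (\<lambda>(a, b) (c, d). {a<..<b} \<inter> {c<..<d} = {}) D \<and>
     (\<Sum>(a, b)\<in>D. b - a) < \<delta> \<longrightarrow>
     (\<Sum>(a, b)\<in>D. \<bar>f b - f a\<bar>) < \<epsilon>)"

lemma abs_cont_real_subset:
  assumes "abs_cont_real S f" "T \<subseteq> S"
  shows "abs_cont_real T f"
  unfolding abs_cont_real_def
proof (intro allI impI)
  fix e :: real assume "0 < e"
  then obtain \<delta> where \<delta>: "\<delta> > 0" and D: "\<And>D. finite D \<Longrightarrow> (\<forall>(a, b) \<in> D. a \<in> S \<and> b \<in> S \<and> a \<le> b) \<Longrightarrow>
      pairwise (\<lambda>(a, b) (c, d). {a<..<b} \<inter> {c<..<d} = {}) D \<Longrightarrow> (\<Sum>(a, b)\<in>D. b - a) < \<delta> \<Longrightarrow>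
      (\<Sum>(a, b)\<in>D. \<bar>f b - f a\<bar>) < e"
    using assms(1) unfolding abs_cont_real_def by meson
  show "\<exists>\<delta>>0. \<forall>D. finite D \<and> (\<forall>(a, b) \<in> D. a \<in> T \<and> b \<in> T \<and> a \<le> b) \<and>
     pairwise (\<lambda>(a, b) (c, d). {a<..<b} \<inter> {c<..<d} = {}) D \<and> (\<Sum>(a, b)\<in>D. b - a) < \<delta> \<longrightarrow>
     (\<Sum>(a, b)\<in>D. \<bar>f b - f a\<bar>) < e"
    using \<delta> assms(2) by (intro exI[of _ \<delta>] conjI allI impI D) auto
qed

lemma abs_cont_real_imp_continuous_on:
  assumes "abs_cont_real S f"
  shows "continuous_on S f"
  unfolding continuous_on_iff
proof (intro ballI allI impI)
  fix t e :: real assume t: "t \<in> S" and e: "0 < e"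
  obtain \<delta> where \<delta>: "\<delta> > 0" and D: "\<And>D. finite D \<Longrightarrow> (\<forall>(a, b) \<in> D. a \<in> S \<and> b \<in> S \<and> a \<le> b) \<Longrightarrow>
      pairwise (\<lambda>(a, b) (c, d). {a<..<b} \<inter> {c<..<d} = {}) D \<Longrightarrow> (\<Sum>(a, b)\<in>D. b - a) < \<delta> \<Longrightarrow>
      (\<Sum>(a, b)\<in>D. \<bar>f b - f a\<bar>) < e"
    using assms e unfolding abs_cont_real_def by meson
  show "\<exists>d>0. \<forall>s\<in>S. dist s t < d \<longrightarrow> dist (f s) (f t) < e"
  proof (intro exI[of _ \<delta>] conjI \<delta> ballI impI)
    fix s assume s: "s \<in> S" and st: "dist s t < \<delta>"
    \<comment> \<open>One interval, oriented by \<open>min\<close> and \<open>max\<close>, is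
      already an admissible family.\<close>
    have "(\<Sum>(a, b)\<in>{(min s t, max s t)}. \<bar>f b - f a\<bar>) < e"
      by (rule D) (use s t st in \<open>auto simp: dist_real_def min_def max_def split: if_splits\<close>)
    then show "dist (f s) (f t) < e"
      by (auto simp: dist_real_def min_def max_def split: if_splits)
  qed
qed

text \<open>The second summand of the bound makes room for the integral of a bounded function, which
  is added to the minimum of the forms before the monotonicity criterion is applied.\<close>

lemma abs_cont_real_dominated:
  assumes x: "abs_cont_on S x" and C: "0 \<le> C"
    and dom: "\<And>s t. s \<in> S \<Longrightarrow> t \<in> S \<Longrightarrow> s \<le> t \<Longrightarrow>
      \<bar>f t - f s\<bar> \<le> C * eucl_norm (x t - x s) + C * (t - s)"
  shows "abs_cont_real S f"
  unfolding abs_cont_real_def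
proof (intro allI impI)
  fix e :: real assume e: "0 < e"
  \<comment> \<open>Both parts of the sum are at most \<open>C * e'\<close>; the
    \<open>C + 1\<close> in the denominator makes the total strictly less than \<open>e\<close>,
    also when \<open>C = 0\<close>.\<close>
  define e' where "e' = e / (2 * (C + 1))"
  have e': "0 < e'" using e C unfolding e'_def by simp
  obtain \<delta> where \<delta>: "\<delta> > 0" and D: "\<And>D. finite D \<Longrightarrow> (\<forall>(a, b) \<in> D. a \<in> S \<and> b \<in> S \<and> a \<le> b) \<Longrightarrow>
      pairwise (\<lambda>(a, b) (c, d). {a<..<b} \<inter> {c<..<d} = {}) D \<Longrightarrow> (\<Sum>(a, b)\<in>D. b - a) < \<delta> \<Longrightarrow>
      (\<Sum>(a, b)\<in>D. eucl_norm (x b - x a)) < e'"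
    using x e' unfolding abs_cont_on_def by meson
  show "\<exists>\<delta>>0. \<forall>D. finite D \<and> (\<forall>(a, b) \<in> D. a \<in> S \<and> b \<in> S \<and> a \<le> b) \<and>
     pairwise (\<lambda>(a, b) (c, d). {a<..<b} \<inter> {c<..<d} = {}) D \<and> (\<Sum>(a, b)\<in>D. b - a) < \<delta> \<longrightarrow>
     (\<Sum>(a, b)\<in>D. \<bar>f b - f a\<bar>) < e"
  proof (intro exI[of _ "min \<delta> e'"] conjI allI impI; (elim conjE)?)
    show "0 < min \<delta> e'" using \<delta> e' by simp
    fix D :: "(real \<times> real) set"
    assume fin: "finite D" and S: "\<forall>(a, b) \<in> D. a \<in> S \<and> b \<in> S \<and> a \<le> b"
      and pw: "pairwise (\<lambda>(a, b) (c, d). {a<..<b} \<inter> {c<..<d} = {}) D"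
      and len: "(\<Sum>(a, b)\<in>D. b - a) < min \<delta> e'"
    have "(\<Sum>(a, b)\<in>D. \<bar>f b - f a\<bar>) \<le> (\<Sum>(a, b)\<in>D. C * eucl_norm (x b - x a) + C * (b - a))"
      by (rule sum_mono) (use S dom in auto)
    also have "\<dots> = C * (\<Sum>(a, b)\<in>D. eucl_norm (x b - x a)) + C * (\<Sum>(a, b)\<in>D. b - a)"
      by (simp add: sum_distrib_left sum.distrib case_prod_unfold)
    also have "\<dots> \<le> C * e' + C * e'"
      using D[OF fin S pw] len C by (intro add_mono mult_left_mono) auto
    also have "\<dots> < 2 * (C + 1) * e'" using e' by (simp add: algebra_simps)
    also have "\<dots> = e" unfolding e'_def using C by (simp add: field_simps)
    finally show "(\<Sum>(a, b)\<in>D. \<bar>f b - f a\<bar>) < e" .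
  qed
qed

text \<open>Admissible families have disjoint interiors but may touch, so the open intervals are the
  ones to compare with \<open>G\<close>. This turns small measure of \<open>G\<close> into the small
  total length that absolute continuity asks for.\<close>

lemma sum_length_disjoint_intervals_le:
  fixes D :: "(real \<times> real) set"
  assumes fin: "finite D" and ord: "\<And>c d. (c, d) \<in> D \<Longrightarrow> c \<le> d"
    and sub: "\<And>c d. (c, d) \<in> D \<Longrightarrow> {c<..<d} \<subseteq> G"
    and pw: "pairwise (\<lambda>(a, b) (c, d). {a<..<b} \<inter> {c<..<d} = {}) D"
    and G: "G \<in> lmeasurable"
  shows "(\<Sum>(c, d)\<in>D. d - c) \<le> measure lebesgue G"
proof -
  have "(\<Sum>(c, d)\<in>D. d - c) = (\<Sum>p\<in>D. measure lebesgue {fst p<..<snd p})"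
    by (rule sum.cong) (use ord in auto)
  also have "\<dots> = measure lebesgue (\<Union>p\<in>D. {fst p<..<snd p})"
  proof (rule measure_UNION_AE[symmetric, OF fin])
    show "pairwise (\<lambda>p q. AE x in lebesgue. x \<notin> {fst p<..<snd p} \<or> x \<notin> {fst q<..<snd q}) D"
      using pw by (fastforce simp: pairwise_def)
  qed (auto intro: lmeasurable_open)
  also have "\<dots> \<le> measure lebesgue G"
    by (rule measure_mono_fmeasurable) (use sub fin G in \<open>force+\<close>)
  finally show ?thesis .
qed

lemma negligible_outer_open:
  fixes S :: "real set"
  assumes "negligible S" "0 < e"
  obtains G where "open G" "S \<subseteq> G" "G \<in> lmeasurable" "measure lebesgue G < e"
proof -
  have S: "S \<in> sets lebesgue" "S \<in> null_sets lebesgue"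
    using assms by (auto simp: negligible_iff_null_sets)
  obtain G where G: "open G" "S \<subseteq> G" "(G - S) \<in> lmeasurable" "emeasure lebesgue (G - S) < ennreal e"
    using sets_lebesgue_outer_open[OF S(1) assms(2)] by blast
  have em: "emeasure lebesgue (G - S) = emeasure lebesgue G"
    by (rule emeasure_Diff_null_set) (use S G in auto)
  have Gm: "G \<in> lmeasurable"
    using G em by (intro fmeasurableI) (auto simp: less_top[symmetric] order_less_le_trans)
  have "ennreal (measure lebesgue G) < ennreal e"
    using G(4) em emeasure_eq_measure2[OF Gm] by simp
  then have "measure lebesgue G < e" using assms(2) by (simp add: ennreal_less_iff)
  then show ?thesis using that G Gm by blast
qed

text \<open>
  Put the exceptional null set into a small open set \<open>G\<close> and let \<open>M t\<close> be the variation of \<open>f\<close> on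
  \<open>G \<inter> {a..t}\<close>, which absolute continuity makes small. The inequality
  \<open>f t - f a \<le> \<epsilon> (t - a) + M t\<close> then propagates to the right from every \<open>t\<close>: by the bound on the
  Dini derivative off \<open>G\<close>, and by the growth of \<open>M\<close> inside \<open>G\<close>.
\<close>

lemma abs_cont_real_Dini_nonincreasing:
  assumes ac: "abs_cont_real {a..b} f" and ab: "a \<le> b"
    and dini: "AE t in lebesgue. a \<le> t \<and> t < b \<longrightarrow>
      (\<forall>\<epsilon>>0. \<forall>\<^sub>F s in at_right t. f s - f t \<le> \<epsilon> * (s - t))"
  shows "f b \<le> f a"
proof -
  have bound: "f b - f a \<le> \<epsilon> * (b - a) + \<eta>" if \<epsilon>: "0 < \<epsilon>" and \<eta>: "0 < \<eta>" for \<epsilon> \<eta>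
  proof -
    obtain \<delta> where \<delta>: "\<delta> > 0"
      and D: "\<And>D. finite D \<Longrightarrow> (\<forall>(c, d) \<in> D. c \<in> {a..b} \<and> d \<in> {a..b} \<and> c \<le> d) \<Longrightarrow>
        pairwise (\<lambda>(a, b) (c, d). {a<..<b} \<inter> {c<..<d} = {}) D \<Longrightarrow> (\<Sum>(c, d)\<in>D. d - c) < \<delta> \<Longrightarrow>
        (\<Sum>(c, d)\<in>D. \<bar>f d - f c\<bar>) < \<eta>"
      using ac \<eta> unfolding abs_cont_real_def by meson
    obtain E where E: "negligible E"
      and good: "\<And>t. a \<le> t \<Longrightarrow> t < b \<Longrightarrow> t \<notin> E \<Longrightarrow> \<forall>\<^sub>F s in at_right t. f s - f t \<le> \<epsilon> * (s - t)"
      using dini \<epsilon> unfolding eventually_ae_filter_negligible by blast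
    obtain G where G: "open G" "E \<subseteq> G" "G \<in> lmeasurable" "measure lebesgue G < \<delta>"
      using negligible_outer_open[OF E \<delta>] by blast
    define \<D> where "\<D> t = {D. finite D \<and> (\<forall>(c, d) \<in> D. a \<le> c \<and> c \<le> d \<and> d \<le> t \<and> {c<..<d} \<subseteq> G) \<and>
        pairwise (\<lambda>(a, b) (c, d). {a<..<b} \<inter> {c<..<d} = {}) D}" for t
    define var where "var D = (\<Sum>(c, d)\<in>D. \<bar>f d - f c\<bar>)" for D
    define M where "M t = Sup (var ` \<D> t)" for t
    \<comment> \<open>The bound is uniform in the family: its lengths add up to at most the measure
      of \<open>G\<close>, which lies below the \<delta> belonging to \<eta>. Hence the suprema
      exist and \<open>M\<close> never exceeds \<eta>.\<close>
    have var_less: "var D < \<eta>" if "D \<in> \<D> t" "t \<le> b" for D t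
    proof -
      have "(\<Sum>(c, d)\<in>D. d - c) \<le> measure lebesgue G"
        by (rule sum_length_disjoint_intervals_le) (use that G in \<open>auto simp: \<D>_def\<close>)
      then show ?thesis
        unfolding var_def using that G(4) by (intro D) (auto simp: \<D>_def)
    qed
    have empty: "{} \<in> \<D> t" for t by (simp add: \<D>_def)
    have bdd: "bdd_above (var ` \<D> t)" if "t \<le> b" for t
      using var_less[OF _ that] by (intro bdd_aboveI[of _ \<eta>]) (auto intro: less_imp_le)
    have var_le_M: "var D \<le> M t" if "D \<in> \<D> t" "t \<le> b" for D t
      unfolding M_def using that bdd by (intro cSup_upper) auto
    have M_le_\<eta>: "M t \<le> \<eta>" if "t \<le> b" for t
      unfolding M_def using var_less[OF _ that] empty by (intro cSup_least) (auto intro: less_imp_le)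
    have M_mono: "M s \<le> M t" if "s \<le> t" "t \<le> b" for s t
      unfolding M_def
    proof (rule cSup_subset_mono)
      show "var ` \<D> s \<subseteq> var ` \<D> t"
        by (rule image_mono) (use that in \<open>force simp: \<D>_def\<close>)
    qed (use empty bdd that in auto)
    \<comment> \<open>Any family up to \<open>t\<close> may be enlarged by the interval from
      \<open>t\<close> to \<open>s\<close>, so inside \<open>G\<close> the increase of
      \<open>M\<close> pays for every change of \<open>f\<close>.\<close>
    have M_step: "M t + \<bar>f s - f t\<bar> \<le> M s" if "a \<le> t" "t < s" "s \<le> b" "{t<..<s} \<subseteq> G" for s t
    proof -
      have "M t \<le> M s - \<bar>f s - f t\<bar>"
        unfolding M_def[of t]
      proof (rule cSup_least)
        show "var ` \<D> t \<noteq> {}" using empty by blast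
        fix v assume "v \<in> var ` \<D> t"
        then obtain D where D: "D \<in> \<D> t" and v: "v = var D" by blast
        \<comment> \<open>All right ends in \<open>D\<close> are at most \<open>t\<close>, so the
          pair ending at \<open>s\<close> is new and the sum gains exactly one term.\<close>
        have notin: "(t, s) \<notin> D" and fin: "finite D"
          and ends: "\<And>c d. (c, d) \<in> D \<Longrightarrow> d \<le> t"
          using D \<open>t < s\<close> by (force simp: \<D>_def)+
        have "insert (t, s) D \<in> \<D> s"
          using D that ends unfolding \<D>_def by (fastforce simp: pairwise_insert)
        then have "var (insert (t, s) D) \<le> M s" using var_le_M that by blast
        then show "v \<le> M s - \<bar>f s - f t\<bar>"
          unfolding v var_def using notin fin by simp
      qed
      then show ?thesis by simp
    qed
    \<comment> \<open>Continuous induction along the interval. \<open>M\<close> need not be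
      continuous: the supremum of \<open>S\<close> is approached from the left, where monotonicity
      of \<open>M\<close> suffices.\<close>
    define S where "S = {t \<in> {a..b}. f t - f a \<le> \<epsilon> * (t - a) + M t}"
    have "0 \<le> M a" using var_le_M[OF empty ab] by (simp add: var_def)
    then have aS: "a \<in> S" using ab by (simp add: S_def)
    have bddS: "bdd_above S" by (rule bdd_aboveI[of _ b]) (auto simp: S_def)
    define u where "u = Sup S"
    have u: "a \<le> u" "u \<le> b"
      unfolding u_def using aS bddS by (auto intro!: cSup_upper cSup_least simp: S_def)
    have cont: "continuous_on {a..b} f" by (rule abs_cont_real_imp_continuous_on[OF ac])
    have uS: "u \<in> S"
    proof -
      have "f u - f a \<le> \<epsilon> * (u - a) + M u + e" if e: "0 < e" for e
      proof -
        obtain d where d: "d > 0" "\<And>s. s \<in> {a..b} \<Longrightarrow> dist s u < d \<Longrightarrow> dist (f s) (f u) < e"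
          using cont u e unfolding continuous_on_iff by (meson atLeastAtMost_iff)
        have "u - d < Sup S" using d unfolding u_def by simp
        then obtain s where s: "s \<in> S" "u - d < s"
          using aS less_cSupD[of S "u - d"] by blast
        have su: "s \<le> u" unfolding u_def by (rule cSup_upper[OF s(1) bddS])
        have "dist (f s) (f u) < e" using d(2)[of s] s su by (auto simp: S_def dist_real_def)
        moreover have "f s - f a \<le> \<epsilon> * (s - a) + M s" using s by (simp add: S_def)
        moreover have "\<epsilon> * (s - a) \<le> \<epsilon> * (u - a)" using su \<epsilon> by simp
        moreover have "M s \<le> M u" using M_mono su u by blast
        ultimately show ?thesis by (simp add: dist_real_def)
      qed
      then have "f u - f a \<le> \<epsilon> * (u - a) + M u" by (rule field_le_epsilon)
      then show ?thesis using u by (simp add: S_def)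
    qed
    have "u = b"
    proof (rule ccontr)
      assume "u \<noteq> b"
      then have ub: "u < b" using u by simp
      have "\<exists>s. u < s \<and> s \<in> S"
      proof (cases "u \<in> E")
        case True
        then obtain d where d: "d > 0" "ball u d \<subseteq> G" using G(1,2) by (meson openE subsetD)
        define s where "s = min b (u + d)"
        have s: "u < s" "s \<le> b" "{u<..<s} \<subseteq> G"
          using ub d by (auto simp: s_def subset_iff dist_real_def)
        have "M u + \<bar>f s - f u\<bar> \<le> M s" by (rule M_step) (use u s in auto)
        moreover have "\<epsilon> * (u - a) \<le> \<epsilon> * (s - a)" using s \<epsilon> by simp
        ultimately have "s \<in> S" using uS s u by (auto simp: S_def)
        then show ?thesis using s by blast
      next
        case False
        then have "\<forall>\<^sub>F s in at_right u. f s - f u \<le> \<epsilon> * (s - u)" using good u ub by blast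
        then obtain c where c: "c > u" "\<And>s. u < s \<Longrightarrow> s < c \<Longrightarrow> f s - f u \<le> \<epsilon> * (s - u)"
          unfolding eventually_at_right_field by blast
        obtain s where s: "u < s" "s < min b c" using dense[of u "min b c"] ub c by auto
        have "f s - f u \<le> \<epsilon> * (s - u)" using c s by simp
        moreover have "M u \<le> M s" using M_mono s by simp
        ultimately have "s \<in> S" using uS s u by (auto simp: S_def algebra_simps)
        then show ?thesis using s by blast
      qed
      then show False using cSup_upper[OF _ bddS] unfolding u_def by (meson not_less)
    qed
    then show ?thesis using uS M_le_\<eta>[of b] by (auto simp: S_def)
  qed
  have "f b - f a \<le> 0 + e" if e: "0 < e" for e
  proof -
    \<comment> \<open>The added 1 covers \<open>a = b\<close>; the slope term and the variation term
      each get half of \<open>e\<close>.\<close>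
    define \<epsilon> where "\<epsilon> = e / (2 * (b - a + 1))"
    have "0 < \<epsilon>" using e ab by (simp add: \<epsilon>_def)
    moreover have "\<epsilon> * (b - a) \<le> e / 2"
      unfolding \<epsilon>_def using e ab by (simp add: field_simps)
    ultimately show ?thesis using bound[of \<epsilon> "e / 2"] e by simp
  qed
  then have "f b - f a \<le> 0" by (rule field_le_epsilon)
  then show ?thesis by simp
qed

section \<open>Quadratic forms and block matrices\<close>

lemma carrier_append_cols [simp, intro]:
  "A \<in> carrier_mat nr nc1 \<Longrightarrow> B \<in> carrier_mat nr nc2 \<Longrightarrow> A @\<^sub>c B \<in> carrier_mat nr (nc1 + nc2)"
  unfolding append_cols_def by auto

lemma append_cols_mult_vec:
  assumes "A \<in> carrier_mat nr nc1" "B \<in> carrier_mat nr nc2" "a \<in> carrier_vec nc1" "b \<in> carrier_vec nc2"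
  shows "(A @\<^sub>c B) *\<^sub>v (a @\<^sub>v b) = A *\<^sub>v a + B *\<^sub>v b"
proof -
  have "(A @\<^sub>c B) *\<^sub>v (a @\<^sub>v b) = (A *\<^sub>v a + B *\<^sub>v b) @\<^sub>v (0\<^sub>m 0 nc1 *\<^sub>v a + 0\<^sub>m 0 nc2 *\<^sub>v b)"
    unfolding append_cols_def using assms by (subst four_block_mat_mult_vec) auto
  also have "\<dots> = A *\<^sub>v a + B *\<^sub>v b" using assms by (intro eq_vecI) auto
  finally show ?thesis .
qed

lemma transpose_append_rows:
  assumes "A \<in> carrier_mat nr1 nc" "B \<in> carrier_mat nr2 nc"
  shows "transpose_mat (A @\<^sub>r B) = transpose_mat A @\<^sub>c transpose_mat B"
  unfolding append_rows_def append_cols_def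
  using assms by (subst transpose_four_block_mat) auto

lemma transpose_append_cols:
  assumes "A \<in> carrier_mat nr nc1" "B \<in> carrier_mat nr nc2"
  shows "transpose_mat (A @\<^sub>c B) = transpose_mat A @\<^sub>r transpose_mat B"
  unfolding append_rows_def append_cols_def
  using assms by (subst transpose_four_block_mat) auto

lemma zero_mat_mult_vec [simp]:
  fixes v :: "real vec"
  shows "v \<in> carrier_vec nc \<Longrightarrow> 0\<^sub>m nr nc *\<^sub>v v = 0\<^sub>v nr"
  by (intro eq_vecI) auto

lemma uminus_mat_mult_vec:
  fixes A :: "real mat"
  shows "A \<in> carrier_mat nr nc \<Longrightarrow> v \<in> carrier_vec nc \<Longrightarrow> (- A) *\<^sub>v v = - (A *\<^sub>v v)"
  by (intro eq_vecI) (auto simp: scalar_prod_def sum_negf)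

lemma mult_mat_uminus_vec:
  fixes A :: "real mat"
  shows "A \<in> carrier_mat nr nc \<Longrightarrow> v \<in> carrier_vec nc \<Longrightarrow> A *\<^sub>v (- v) = - (A *\<^sub>v v)"
  by (intro eq_vecI) (auto simp: scalar_prod_def sum_negf)

lemma smult_mat_mult_vec:
  fixes A :: "real mat"
  shows "A \<in> carrier_mat nr nc \<Longrightarrow> v \<in> carrier_vec nc \<Longrightarrow> (c \<cdot>\<^sub>m A) *\<^sub>v v = c \<cdot>\<^sub>v (A *\<^sub>v v)"
  by (intro eq_vecI) (auto simp: scalar_prod_def sum_distrib_left mult.assoc)

lemma minus_mat_mult_vec:
  fixes A B :: "real mat"
  shows "A \<in> carrier_mat nr nc \<Longrightarrow> B \<in> carrier_mat nr nc \<Longrightarrow> v \<in> carrier_vec nc \<Longrightarrow>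
    (A - B) *\<^sub>v v = A *\<^sub>v v - B *\<^sub>v v"
  by (intro eq_vecI) (auto simp: scalar_prod_def sum_subtractf algebra_simps)

lemma scalar_prod_uminus:
  fixes v w :: "real vec"
  assumes "v \<in> carrier_vec n" "w \<in> carrier_vec n"
  shows "v \<bullet> (- w) = - (v \<bullet> w)" "(- v) \<bullet> w = - (v \<bullet> w)"
  using assms by (auto simp: scalar_prod_def sum_negf)

lemma scalar_prod_minus_right:
  fixes u v w :: "real vec"
  assumes "u \<in> carrier_vec n" "v \<in> carrier_vec n" "w \<in> carrier_vec n"
  shows "u \<bullet> (v - w) = u \<bullet> v - u \<bullet> w"
  using assms by (auto simp: scalar_prod_def sum_subtractf algebra_simps)

lemma scalar_prod_mult_mat_vec:
  fixes A :: "real mat"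
  assumes "A \<in> carrier_mat n n" "x \<in> carrier_vec n" "y \<in> carrier_vec n"
  shows "x \<bullet> (A *\<^sub>v y) = (\<Sum>i<n. \<Sum>j<n. A $$ (i, j) * (x $ i * y $ j))"
  using assms by (auto simp: scalar_prod_def sum_distrib_left atLeast0LessThan intro!: sum.cong)

lemma pos_def_symmetric:
  assumes A: "A \<in> carrier_mat n n" and pd: "pos_def A"
    and x: "x \<in> carrier_vec n" and y: "y \<in> carrier_vec n"
  shows "(A *\<^sub>v x) \<bullet> y = x \<bullet> (A *\<^sub>v y)"
  using transpose_vec_mult_scalar[OF A y x] pd by (simp add: pos_def_def)

lemma pos_def_minv:
  assumes A: "A \<in> carrier_mat n n" and pd: "pos_def A"
  shows "minv A \<in> carrier_mat n n" "A * minv A = 1\<^sub>m n" "minv A * A = 1\<^sub>m n"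
proof -
  have "det A \<noteq> 0"
  proof
    assume "det A = 0"
    then obtain v where v: "v \<in> carrier_vec n" "v \<noteq> 0\<^sub>v n" "A *\<^sub>v v = 0\<^sub>v n"
      using det_0_iff_vec_prod_zero[OF A] by blast
    then have "0 < v \<bullet> (A *\<^sub>v v)" using pd A by (auto simp: pos_def_def)
    then show False using v by simp
  qed
  then have "A \<in> Units (ring_mat TYPE(real) n ())" by (rule det_non_zero_imp_unit[OF A])
  then obtain B where B: "mat_inverse A = Some B"
    using mat_inverse(1)[OF A, of "()"] by (cases "mat_inverse A") auto
  from mat_inverse(2)[OF A B] B
  show "minv A \<in> carrier_mat n n" "A * minv A = 1\<^sub>m n" "minv A * A = 1\<^sub>m n"
    by (auto simp: minv_def)
qed

lemma minv_mult_cancel: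
  assumes "A \<in> carrier_mat n n" "pos_def A" "x \<in> carrier_vec n"
  shows "minv A *\<^sub>v (A *\<^sub>v x) = x" "A *\<^sub>v (minv A *\<^sub>v x) = x"
  using pos_def_minv[OF assms(1,2)] assms(1,3)
    assoc_mult_mat_vec[of "minv A" n n A n x] assoc_mult_mat_vec[of A n n "minv A" n x]
  by auto

section \<open>Euclidean norm and bounds for quadratic forms\<close>

lemma scalar_prod_self_nonneg: "0 \<le> (v :: real vec) \<bullet> v"
  by (auto simp: scalar_prod_def intro: sum_nonneg)

lemma component_le_eucl_norm:
  assumes "k < dim_vec v"
  shows "\<bar>v $ k\<bar> \<le> eucl_norm v"
proof -
  have "(v $ k)\<^sup>2 \<le> v \<bullet> v"
    unfolding scalar_prod_def power2_eq_square
    using assms by (intro member_le_sum) auto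
  then show ?thesis unfolding eucl_norm_def by (metis real_sqrt_abs real_sqrt_le_mono)
qed

lemma eucl_norm_nonneg [simp]: "0 \<le> eucl_norm v"
  by (simp add: eucl_norm_def scalar_prod_self_nonneg)

lemma eucl_norm_square: "(eucl_norm v)\<^sup>2 = v \<bullet> v"
  by (simp add: eucl_norm_def scalar_prod_self_nonneg)

lemma quadratic_form_le:
  fixes A :: "real mat"
  assumes A: "A \<in> carrier_mat n n"
  obtains C where "0 < C" "\<And>v. v \<in> carrier_vec n \<Longrightarrow> v \<bullet> (A *\<^sub>v v) \<le> C * (v \<bullet> v)"
proof
  \<comment> \<open>The summand 1 keeps \<open>C\<close> positive when all entries vanish or
    \<open>n = 0\<close>; the lower bound for positive definite forms takes its reciprocal.\<close>
  define C where "C = (\<Sum>i<n. \<Sum>j<n. \<bar>A $$ (i, j)\<bar>) + 1"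
  show "0 < C" unfolding C_def by (intro add_nonneg_pos sum_nonneg) auto
  fix v :: "real vec" assume v: "v \<in> carrier_vec n"
  have "v \<bullet> (A *\<^sub>v v) \<le> (\<Sum>i<n. \<Sum>j<n. \<bar>A $$ (i, j)\<bar> * (v \<bullet> v))"
    unfolding scalar_prod_mult_mat_vec[OF A v v]
  proof (intro sum_mono)
    fix i j assume ij: "i \<in> {..<n}" "j \<in> {..<n}"
    have "\<bar>v $ i * v $ j\<bar> \<le> eucl_norm v * eucl_norm v"
      unfolding abs_mult using ij v by (intro mult_mono component_le_eucl_norm) auto
    also have "\<dots> = v \<bullet> v" by (metis eucl_norm_square power2_eq_square)
    finally have "\<bar>A $$ (i, j)\<bar> * \<bar>v $ i * v $ j\<bar> \<le> \<bar>A $$ (i, j)\<bar> * (v \<bullet> v)"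
      by (intro mult_left_mono) auto
    then show "A $$ (i, j) * (v $ i * v $ j) \<le> \<bar>A $$ (i, j)\<bar> * (v \<bullet> v)"
      by (metis abs_le_D1 abs_mult)
  qed
  also have "\<dots> \<le> C * (v \<bullet> v)"
    unfolding C_def using scalar_prod_self_nonneg[of v]
    by (simp add: sum_distrib_right distrib_right)
  finally show "v \<bullet> (A *\<^sub>v v) \<le> C * (v \<bullet> v)" .
qed

text \<open>
  With an upper bound \<open>C\<close> for the form of the inverse, nonnegativity of the form of \<open>A\<close> at
  \<open>v - (1/C) A\<inverse> v\<close> gives the lower bound \<open>1/C\<close>; no compactness of the sphere is needed.
\<close>

lemma pos_def_form_ge:
  assumes A: "A \<in> carrier_mat n n" and pd: "pos_def A"
  obtains c where "0 < c" "\<And>v. v \<in> carrier_vec n \<Longrightarrow> c * (v \<bullet> v) \<le> v \<bullet> (A *\<^sub>v v)"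
proof -
  note R = pos_def_minv[OF A pd]
  obtain C where C: "0 < C" "\<And>v. v \<in> carrier_vec n \<Longrightarrow> v \<bullet> (minv A *\<^sub>v v) \<le> C * (v \<bullet> v)"
    using quadratic_form_le[OF R(1)] by blast
  show ?thesis
  proof (rule that[of "1 / C"])
    show "0 < 1 / C" using C by simp
    fix v :: "real vec" assume v: "v \<in> carrier_vec n"
    define w where "w = minv A *\<^sub>v v"
    have w: "w \<in> carrier_vec n" unfolding w_def using R(1) v by simp
    have Aw: "A *\<^sub>v w = v" unfolding w_def by (rule minv_mult_cancel[OF A pd v])
    define u where "u = v - (1 / C) \<cdot>\<^sub>v w"
    have u: "u \<in> carrier_vec n" using v w by (simp add: u_def)
    have Au: "A *\<^sub>v u = A *\<^sub>v v - (1 / C) \<cdot>\<^sub>v v"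
      unfolding u_def using A v w mult_mat_vec[OF A w]
      by (simp add: mult_minus_distrib_mat_vec[of _ n n] Aw)
    have "0 \<le> u \<bullet> (A *\<^sub>v u)"
    proof (cases "u = 0\<^sub>v n")
      case True
      then show ?thesis using A by simp
    next
      case False
      then show ?thesis using pd u A by (auto simp: pos_def_def less_imp_le)
    qed
    \<comment> \<open>Since \<open>A\<close> is symmetric and maps \<open>w\<close> to
      \<open>v\<close>, both mixed terms equal v \<bullet> v divided by \<open>C\<close>; this is
      the source of the factor 2.\<close>
    also have "u \<bullet> (A *\<^sub>v u) = v \<bullet> (A *\<^sub>v v) - 2 / C * (v \<bullet> v) + (1 / C)\<^sup>2 * (v \<bullet> w)"
    proof -
      have Av: "A *\<^sub>v v \<in> carrier_vec n" using A v by simp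
      have "w \<bullet> (A *\<^sub>v v) = v \<bullet> v" using pos_def_symmetric[OF A pd w v] Aw by simp
      moreover have "w \<bullet> v = v \<bullet> w" using comm_scalar_prod v w by blast
      ultimately show ?thesis
        unfolding Au using v w Av unfolding u_def
        by (simp add: minus_scalar_prod_distrib[of _ n] scalar_prod_minus_right[of _ n]
            power2_eq_square diff_divide_distrib)
    qed
    also have "\<dots> \<le> v \<bullet> (A *\<^sub>v v) - 2 / C * (v \<bullet> v) + (1 / C)\<^sup>2 * (C * (v \<bullet> v))"
      using C(2)[OF v] unfolding w_def by (intro add_left_mono mult_left_mono) auto
    also have "\<dots> = v \<bullet> (A *\<^sub>v v) - 1 / C * (v \<bullet> v)"
      using C(1) by (simp add: power2_eq_square field_simps)
    finally show "1 / C * (v \<bullet> v) \<le> v \<bullet> (A *\<^sub>v v)" by simp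
  qed
qed

text \<open>The box is described by coordinates because this is what the uses supply: a bounded
  neighbourhood of a point, and a curve whose coordinates are continuous on a compact
  interval.\<close>

lemma quadratic_form_Lipschitz:
  fixes A :: "real mat"
  assumes A: "A \<in> carrier_mat n n" and M: "0 \<le> M"
  obtains C where "0 \<le> C"
    "\<And>y z. \<lbrakk>y \<in> carrier_vec n; z \<in> carrier_vec n; \<And>k. k < n \<Longrightarrow> \<bar>y $ k\<bar> \<le> M; \<And>k. k < n \<Longrightarrow> \<bar>z $ k\<bar> \<le> M\<rbrakk>
      \<Longrightarrow> \<bar>y \<bullet> (A *\<^sub>v y) - z \<bullet> (A *\<^sub>v z)\<bar> \<le> C * eucl_norm (y - z)"
proof
  define C where "C = (\<Sum>i<n. \<Sum>j<n. \<bar>A $$ (i, j)\<bar> * (2 * M))"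
  show "0 \<le> C" unfolding C_def using M by (intro sum_nonneg) auto
  fix y z :: "real vec"
  assume y: "y \<in> carrier_vec n" and z: "z \<in> carrier_vec n"
    and My: "\<And>k. k < n \<Longrightarrow> \<bar>y $ k\<bar> \<le> M" and Mz: "\<And>k. k < n \<Longrightarrow> \<bar>z $ k\<bar> \<le> M"
  have diff: "\<bar>y $ k - z $ k\<bar> \<le> eucl_norm (y - z)" if "k < n" for k
    using component_le_eucl_norm[of k "y - z"] that y z by auto
  have "\<bar>y \<bullet> (A *\<^sub>v y) - z \<bullet> (A *\<^sub>v z)\<bar>
      = \<bar>\<Sum>i<n. \<Sum>j<n. A $$ (i, j) * (y $ i * y $ j - z $ i * z $ j)\<bar>"
    unfolding scalar_prod_mult_mat_vec[OF A y y] scalar_prod_mult_mat_vec[OF A z z]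
    by (simp add: sum_subtractf right_diff_distrib)
  also have "\<dots> \<le> (\<Sum>i<n. \<Sum>j<n. \<bar>A $$ (i, j)\<bar> * (2 * M) * eucl_norm (y - z))"
  proof (rule order_trans[OF sum_abs], rule sum_mono, rule order_trans[OF sum_abs], rule sum_mono)
    fix i j assume ij: "i \<in> {..<n}" "j \<in> {..<n}"
    \<comment> \<open>Inserting \<open>y $ i * z $ j\<close> leaves one bounded and one small factor
      in each summand.\<close>
    have "\<bar>y $ i * y $ j - z $ i * z $ j\<bar> = \<bar>y $ i * (y $ j - z $ j) + (y $ i - z $ i) * z $ j\<bar>"
      by (simp add: algebra_simps)
    also have "\<dots> \<le> \<bar>y $ i\<bar> * \<bar>y $ j - z $ j\<bar> + \<bar>y $ i - z $ i\<bar> * \<bar>z $ j\<bar>"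
      by (metis abs_mult abs_triangle_ineq)
    also have "\<dots> \<le> M * eucl_norm (y - z) + eucl_norm (y - z) * M"
      using ij My Mz diff M by (intro add_mono mult_mono) auto
    finally have "\<bar>y $ i * y $ j - z $ i * z $ j\<bar> \<le> 2 * M * eucl_norm (y - z)" by simp
    then show "\<bar>A $$ (i, j) * (y $ i * y $ j - z $ i * z $ j)\<bar> \<le> \<bar>A $$ (i, j)\<bar> * (2 * M) * eucl_norm (y - z)"
      unfolding abs_mult mult.assoc by (intro mult_left_mono) auto
  qed
  also have "\<dots> = C * eucl_norm (y - z)" unfolding C_def by (simp add: sum_distrib_right)
  finally show "\<bar>y \<bullet> (A *\<^sub>v y) - z \<bullet> (A *\<^sub>v z)\<bar> \<le> C * eucl_norm (y - z)" .
qed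

section \<open>Vectors and matrices cut into five blocks\<close>

lemma append_cols5_mult_vec:
  assumes "A1 \<in> carrier_mat r c1" "A2 \<in> carrier_mat r c2" "A3 \<in> carrier_mat r c3"
    "A4 \<in> carrier_mat r c4" "A5 \<in> carrier_mat r c5"
    "a1 \<in> carrier_vec c1" "a2 \<in> carrier_vec c2" "a3 \<in> carrier_vec c3"
    "a4 \<in> carrier_vec c4" "a5 \<in> carrier_vec c5"
  shows "(A1 @\<^sub>c A2 @\<^sub>c A3 @\<^sub>c A4 @\<^sub>c A5) *\<^sub>v (a1 @\<^sub>v a2 @\<^sub>v a3 @\<^sub>v a4 @\<^sub>v a5) =
    A1 *\<^sub>v a1 + (A2 *\<^sub>v a2 + (A3 *\<^sub>v a3 + (A4 *\<^sub>v a4 + A5 *\<^sub>v a5)))"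
proof -
  \<comment> \<open>Blocks are peeled off from the left one at a time, so every remaining tail is
    given its exact dimensions first.\<close>
  have c4: "A4 @\<^sub>c A5 \<in> carrier_mat r (c4 + c5)" "a4 @\<^sub>v a5 \<in> carrier_vec (c4 + c5)"
    using assms by blast+
  have c3: "A3 @\<^sub>c A4 @\<^sub>c A5 \<in> carrier_mat r (c3 + (c4 + c5))"
    "a3 @\<^sub>v a4 @\<^sub>v a5 \<in> carrier_vec (c3 + (c4 + c5))"
    using assms c4 by blast+
  have c2: "A2 @\<^sub>c A3 @\<^sub>c A4 @\<^sub>c A5 \<in> carrier_mat r (c2 + (c3 + (c4 + c5)))"
    "a2 @\<^sub>v a3 @\<^sub>v a4 @\<^sub>v a5 \<in> carrier_vec (c2 + (c3 + (c4 + c5)))"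
    using assms c3 by blast+
  show ?thesis
    by (simp only: append_cols_mult_vec[OF assms(1) c2(1) assms(6) c2(2)]
        append_cols_mult_vec[OF assms(2) c3(1) assms(7) c3(2)]
        append_cols_mult_vec[OF assms(3) c4(1) assms(8) c4(2)]
        append_cols_mult_vec[OF assms(4,5,9,10)])
qed

lemma append_rows5_mult_vec:
  assumes "A1 \<in> carrier_mat r1 c" "A2 \<in> carrier_mat r2 c" "A3 \<in> carrier_mat r3 c"
    "A4 \<in> carrier_mat r4 c" "A5 \<in> carrier_mat r5 c" "v \<in> carrier_vec c"
  shows "(A1 @\<^sub>r A2 @\<^sub>r A3 @\<^sub>r A4 @\<^sub>r A5) *\<^sub>v v =
    A1 *\<^sub>v v @\<^sub>v A2 *\<^sub>v v @\<^sub>v A3 *\<^sub>v v @\<^sub>v A4 *\<^sub>v v @\<^sub>v A5 *\<^sub>v v"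
proof -
  have c4: "A4 @\<^sub>r A5 \<in> carrier_mat (r4 + r5) c" using assms by blast
  have c3: "A3 @\<^sub>r A4 @\<^sub>r A5 \<in> carrier_mat (r3 + (r4 + r5)) c" using assms c4 by blast
  have c2: "A2 @\<^sub>r A3 @\<^sub>r A4 @\<^sub>r A5 \<in> carrier_mat (r2 + (r3 + (r4 + r5))) c" using assms c3 by blast
  show ?thesis
    by (simp only: mat_mult_append[OF assms(1) c2 assms(6)] mat_mult_append[OF assms(2) c3 assms(6)]
        mat_mult_append[OF assms(3) c4 assms(6)] mat_mult_append[OF assms(4) assms(5) assms(6)])
qed

lemma scalar_prod_append5:
  fixes a1 :: "real vec"
  assumes "a1 \<in> carrier_vec c1" "a2 \<in> carrier_vec c2" "a3 \<in> carrier_vec c3"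
    "a4 \<in> carrier_vec c4" "a5 \<in> carrier_vec c5"
    "b1 \<in> carrier_vec c1" "b2 \<in> carrier_vec c2" "b3 \<in> carrier_vec c3"
    "b4 \<in> carrier_vec c4" "b5 \<in> carrier_vec c5"
  shows "(a1 @\<^sub>v a2 @\<^sub>v a3 @\<^sub>v a4 @\<^sub>v a5) \<bullet> (b1 @\<^sub>v b2 @\<^sub>v b3 @\<^sub>v b4 @\<^sub>v b5) =
    a1 \<bullet> b1 + (a2 \<bullet> b2 + (a3 \<bullet> b3 + (a4 \<bullet> b4 + a5 \<bullet> b5)))"
proof -
  have c4: "a4 @\<^sub>v a5 \<in> carrier_vec (c4 + c5)" "b4 @\<^sub>v b5 \<in> carrier_vec (c4 + c5)"
    using assms by blast+
  have c3: "a3 @\<^sub>v a4 @\<^sub>v a5 \<in> carrier_vec (c3 + (c4 + c5))"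
    "b3 @\<^sub>v b4 @\<^sub>v b5 \<in> carrier_vec (c3 + (c4 + c5))"
    using assms c4 by blast+
  have c2: "a2 @\<^sub>v a3 @\<^sub>v a4 @\<^sub>v a5 \<in> carrier_vec (c2 + (c3 + (c4 + c5)))"
    "b2 @\<^sub>v b3 @\<^sub>v b4 @\<^sub>v b5 \<in> carrier_vec (c2 + (c3 + (c4 + c5)))"
    using assms c3 by blast+
  show ?thesis
    by (simp only: scalar_prod_append[OF assms(1) c2(1) assms(6) c2(2)]
        scalar_prod_append[OF assms(2) c3(1) assms(7) c3(2)]
        scalar_prod_append[OF assms(3) c4(1) assms(8) c4(2)]
        scalar_prod_append[OF assms(4,5,9,10)])
qed

section \<open>Stacked copies of a vector and the block diagonal of the remaining modes\<close>

lemma ones_kronecker_mult_vec: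
  assumes x: "x \<in> carrier_vec n"
  shows "(ones_col k \<otimes>\<^sub>K 1\<^sub>m n) *\<^sub>v x = vec (k * n) (\<lambda>r. x $ (r mod n))"
proof (rule eq_vecI)
  fix r assume "r < dim_vec (vec (k * n) (\<lambda>r. x $ (r mod n)))"
  then have r: "r < k * n" by simp
  \<comment> \<open>An index below \<open>k * n\<close> exists, so \<open>n\<close> is positive;
    quotient and remainder by \<open>n\<close> then give the copy and the coordinate.\<close>
  then have n: "0 < n" by (cases n) auto
  have "r div n < k" using r n by (simp add: less_mult_imp_div_less)
  then have "((ones_col k \<otimes>\<^sub>K 1\<^sub>m n) *\<^sub>v x) $ r = (\<Sum>c<n. (if r mod n = c then 1 else 0) * x $ c)"
    using r x n by (auto simp: kronecker_def ones_col_def scalar_prod_def atLeast0LessThan intro!: sum.cong)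
  also have "\<dots> = x $ (r mod n)" using n by (simp add: if_distrib[of "\<lambda>c. c * _"] cong: if_cong)
  finally show "((ones_col k \<otimes>\<^sub>K 1\<^sub>m n) *\<^sub>v x) $ r = vec (k * n) (\<lambda>r. x $ (r mod n)) $ r"
    using r by simp
qed (simp add: kronecker_def ones_col_def)

lemma carrier_ones_kronecker [simp]: "ones_col k \<otimes>\<^sub>K 1\<^sub>m n \<in> carrier_mat (k * n) n"
  by (simp add: kronecker_def ones_col_def)

text \<open>Splitting off the first copy follows the recursion of \<open>diag_block_mat\<close>,
  along which the form is evaluated below.\<close>

lemma ones_kronecker_Suc_mult_vec:
  assumes x: "x \<in> carrier_vec n"
  shows "(ones_col (Suc k) \<otimes>\<^sub>K 1\<^sub>m n) *\<^sub>v x = x @\<^sub>v ((ones_col k \<otimes>\<^sub>K 1\<^sub>m n) *\<^sub>v x)"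
  unfolding ones_kronecker_mult_vec[OF x]
  using x by (intro eq_vecI) (auto simp: le_mod_geq)

lemma pos_def_four_block_diag:
  assumes A: "A \<in> carrier_mat n n" "pos_def A" and B: "B \<in> carrier_mat k k" "pos_def B"
  shows "pos_def (four_block_mat A (0\<^sub>m n k) (0\<^sub>m k n) B)" (is "pos_def ?F")
  unfolding pos_def_def
proof (intro conjI ballI impI)
  have F: "?F \<in> carrier_mat (n + k) (n + k)" using A B by auto
  then show "square_mat ?F" by (metis carrier_matD square_mat.simps)
  show "transpose_mat ?F = ?F"
    using A B by (subst transpose_four_block_mat) (auto simp: pos_def_def)
  fix v :: "real vec" assume "v \<in> carrier_vec (dim_row ?F)" and nz: "v \<noteq> 0\<^sub>v (dim_row ?F)"
  then have v: "v \<in> carrier_vec (n + k)" using F by auto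
  define a where "a = vec_first v n"
  define b where "b = vec_last v k"
  have a: "a \<in> carrier_vec n" and b: "b \<in> carrier_vec k" by (auto simp: a_def b_def)
  have vab: "v = a @\<^sub>v b" using v by (simp add: a_def b_def)
  have Fv: "?F *\<^sub>v v = (A *\<^sub>v a) @\<^sub>v (B *\<^sub>v b)"
    unfolding vab using A B a b by (subst four_block_mat_mult_vec) auto
  have "v \<bullet> (?F *\<^sub>v v) = a \<bullet> (A *\<^sub>v a) + b \<bullet> (B *\<^sub>v b)"
    unfolding Fv unfolding vab by (rule scalar_prod_append) (use A B a b in auto)
  moreover have "a \<noteq> 0\<^sub>v n \<or> b \<noteq> 0\<^sub>v k"
  proof (rule ccontr)
    assume "\<not> ?thesis"
    then have "v = 0\<^sub>v (n + k)" unfolding vab by (intro eq_vecI) auto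
    then show False using nz F by auto
  qed
  moreover have "a \<noteq> 0\<^sub>v n \<Longrightarrow> 0 < a \<bullet> (A *\<^sub>v a)" "b \<noteq> 0\<^sub>v k \<Longrightarrow> 0 < b \<bullet> (B *\<^sub>v b)"
    using A B a b by (auto simp: pos_def_def)
  moreover have "a = 0\<^sub>v n \<Longrightarrow> a \<bullet> (A *\<^sub>v a) = 0" "b = 0\<^sub>v k \<Longrightarrow> b \<bullet> (B *\<^sub>v b) = 0"
    using A B by auto
  ultimately show "0 < v \<bullet> (?F *\<^sub>v v)" by (metis add_pos_pos add.right_neutral add.left_neutral)
qed

lemma diag_block_mat_pos_def:
  assumes "\<And>A. A \<in> set As \<Longrightarrow> A \<in> carrier_mat n n \<and> pos_def A"
  shows "diag_block_mat As \<in> carrier_mat (length As * n) (length As * n) \<and> pos_def (diag_block_mat As)"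
  using assms
proof (induction As)
  case Nil
  \<comment> \<open>The empty block diagonal is the 0 by 0 matrix, positive definite because its
    only vector is zero. This is the situation for \<open>N = 1\<close>.\<close>
  show ?case by (auto simp: pos_def_def)
next
  case (Cons A As)
  define k where "k = length As * n"
  have A: "A \<in> carrier_mat n n" "pos_def A" using Cons.prems by auto
  have B: "diag_block_mat As \<in> carrier_mat k k" "pos_def (diag_block_mat As)"
    using Cons by (auto simp: k_def)
  have eq: "diag_block_mat (A # As) = four_block_mat A (0\<^sub>m n k) (0\<^sub>m k n) (diag_block_mat As)"
    using A B by (auto simp: Let_def)
  have "diag_block_mat (A # As) \<in> carrier_mat (n + k) (n + k)" unfolding eq using A B by auto
  then show ?case
    unfolding eq using pos_def_four_block_diag[OF A B] by (simp add: k_def)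
qed

text \<open>Stacked copies of \<open>x\<close> hit every diagonal block with the same vector. In
  this way the second block row of the matrix inequality delivers the forms of all other modes at
  once.\<close>

lemma diag_block_mat_form_ones:
  assumes "\<And>A. A \<in> set As \<Longrightarrow> A \<in> carrier_mat n n \<and> pos_def A" and x: "x \<in> carrier_vec n"
  defines "e \<equiv> \<lambda>k. (ones_col k \<otimes>\<^sub>K 1\<^sub>m n) *\<^sub>v x"
  shows "e (length As) \<bullet> (diag_block_mat As *\<^sub>v e (length As)) = (\<Sum>A\<leftarrow>As. x \<bullet> (A *\<^sub>v x))"
  using assms(1)
proof (induction As)
  case Nil
  show ?case by (auto simp: scalar_prod_def)
next
  case (Cons A As)
  define k where "k = length As * n"
  have A: "A \<in> carrier_mat n n" using Cons.prems by auto
  have B: "diag_block_mat As \<in> carrier_mat k k"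
    using diag_block_mat_pos_def[of As n] Cons.prems by (auto simp: k_def)
  have eq: "diag_block_mat (A # As) = four_block_mat A (0\<^sub>m n k) (0\<^sub>m k n) (diag_block_mat As)"
    using A B by (auto simp: Let_def)
  have e: "e (length As) \<in> carrier_vec k"
    unfolding e_def k_def using carrier_ones_kronecker[of "length As" n] x by (metis mult_mat_vec_carrier)
  have eS: "e (length (A # As)) = x @\<^sub>v e (length As)"
    unfolding e_def using ones_kronecker_Suc_mult_vec[OF x] by simp
  have "diag_block_mat (A # As) *\<^sub>v e (length (A # As)) = (A *\<^sub>v x) @\<^sub>v (diag_block_mat As *\<^sub>v e (length As))"
    unfolding eq eS using A B x e by (subst four_block_mat_mult_vec) auto
  then have "e (length (A # As)) \<bullet> (diag_block_mat (A # As) *\<^sub>v e (length (A # As)))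
      = x \<bullet> (A *\<^sub>v x) + e (length As) \<bullet> (diag_block_mat As *\<^sub>v e (length As))"
    unfolding eS using A B x e by (simp add: scalar_prod_append[of _ n _ k])
  then show ?case using Cons by simp
qed

lemma length_filter_neq_upt:
  assumes "i \<in> {1..N}"
  shows "length (filter (\<lambda>j. j \<noteq> i) [1..<Suc N]) = N - 1"
proof -
  have "length (filter (\<lambda>j. j \<noteq> i) [1..<Suc N]) = card (set (filter (\<lambda>j. j \<noteq> i) [1..<Suc N]))"
    by (rule distinct_card[symmetric]) (rule distinct_filter, rule distinct_upt)
  also have "set (filter (\<lambda>j. j \<noteq> i) [1..<Suc N]) = {1..N} - {i}" by auto
  finally show ?thesis using assms by simp
qed

lemma diag_others_pos_def:
  assumes i: "i \<in> {1..N}" and P: "\<And>j. j \<in> {1..N} \<Longrightarrow> P j \<in> carrier_mat n n \<and> pos_def (P j)"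
  shows "diag_others N P i \<in> carrier_mat ((N - 1) * n) ((N - 1) * n)" "pos_def (diag_others N P i)"
proof -
  have "A \<in> carrier_mat n n \<and> pos_def A" if "A \<in> set (map P (filter (\<lambda>j. j \<noteq> i) [1..<Suc N]))" for A
    using that P by auto
  from diag_block_mat_pos_def[of "map P (filter (\<lambda>j. j \<noteq> i) [1..<Suc N])" n, OF this]
  show "diag_others N P i \<in> carrier_mat ((N - 1) * n) ((N - 1) * n)" "pos_def (diag_others N P i)"
    using length_filter_neq_upt[OF i] by (simp_all add: diag_others_def del: upt_Suc)
qed

lemma diag_others_form_ones:
  assumes i: "i \<in> {1..N}" and P: "\<And>j. j \<in> {1..N} \<Longrightarrow> P j \<in> carrier_mat n n \<and> pos_def (P j)"
    and x: "x \<in> carrier_vec n"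
  defines "e \<equiv> (ones_col (N - 1) \<otimes>\<^sub>K 1\<^sub>m n) *\<^sub>v x"
  shows "e \<bullet> (diag_others N P i *\<^sub>v e) = (\<Sum>j\<in>{1..N} - {i}. x \<bullet> (P j *\<^sub>v x))"
proof -
  let ?js = "filter (\<lambda>j. j \<noteq> i) [1..<Suc N]"
  have "e \<bullet> (diag_others N P i *\<^sub>v e) = (\<Sum>A\<leftarrow>map P ?js. x \<bullet> (A *\<^sub>v x))"
  proof -
    have "A \<in> carrier_mat n n \<and> pos_def A" if "A \<in> set (map P ?js)" for A
      using that P by auto
    from diag_block_mat_form_ones[of "map P ?js" n, OF this x] show ?thesis
      using length_filter_neq_upt[OF i] by (simp add: diag_others_def e_def del: upt_Suc)
  qed
  also have "\<dots> = (\<Sum>j\<leftarrow>?js. x \<bullet> (P j *\<^sub>v x))" by (simp add: o_def del: upt_Suc)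
  also have "\<dots> = (\<Sum>j\<in>set ?js. x \<bullet> (P j *\<^sub>v x))"
    by (rule sum_list_distinct_conv_sum_set) (rule distinct_filter, rule distinct_upt)
  also have "set ?js = {1..N} - {i}" by auto
  finally show ?thesis .
qed

section \<open>Consequences of the matrix inequality\<close>

text \<open>The first two row blocks of the data matrix vanish, so \<open>v1\<close> and
  \<open>v2\<close> do not affect the data term and can be reserved for the Schur
  complement.\<close>

lemma data_mat_transpose_mult_vec:
  assumes X: "X \<in> carrier_mat n T" and Xd: "Xd \<in> carrier_mat n T" and U: "U \<in> carrier_mat m T"
    and v: "v1 \<in> carrier_vec n" "v2 \<in> carrier_vec ((N - 1) * n)" "y \<in> carrier_vec n"
      "z \<in> carrier_vec n" "u \<in> carrier_vec m"
  shows "transpose_mat (data_mat n m N T Xd X U) *\<^sub>v (v1 @\<^sub>v v2 @\<^sub>v y @\<^sub>v z @\<^sub>v u) =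
    y @\<^sub>v (transpose_mat Xd *\<^sub>v y - transpose_mat X *\<^sub>v z - transpose_mat U *\<^sub>v u)"
proof -
  define k where "k = (N - 1) * n"
  note v = v[folded k_def]
  define G1 where "G1 = (0\<^sub>m n n :: real mat) @\<^sub>c 0\<^sub>m n T"
  define G2 where "G2 = (0\<^sub>m k n :: real mat) @\<^sub>c 0\<^sub>m k T"
  define G3 where "G3 = 1\<^sub>m n @\<^sub>c Xd"
  define G4 where "G4 = 0\<^sub>m n n @\<^sub>c - X"
  define G5 where "G5 = 0\<^sub>m m n @\<^sub>c - U"
  have G: "G1 \<in> carrier_mat n (n + T)" "G2 \<in> carrier_mat k (n + T)" "G3 \<in> carrier_mat n (n + T)"
    "G4 \<in> carrier_mat n (n + T)" "G5 \<in> carrier_mat m (n + T)"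
    unfolding G1_def G2_def G3_def G4_def G5_def using X Xd U by auto
  have c4: "G4 @\<^sub>r G5 \<in> carrier_mat (n + m) (n + T)" using G by blast
  have c3: "G3 @\<^sub>r G4 @\<^sub>r G5 \<in> carrier_mat (n + (n + m)) (n + T)" using G c4 by blast
  have c2: "G2 @\<^sub>r G3 @\<^sub>r G4 @\<^sub>r G5 \<in> carrier_mat (k + (n + (n + m))) (n + T)" using G c3 by blast
  have eq: "transpose_mat (data_mat n m N T Xd X U) =
      transpose_mat G1 @\<^sub>c transpose_mat G2 @\<^sub>c transpose_mat G3 @\<^sub>c transpose_mat G4 @\<^sub>c transpose_mat G5"
    unfolding data_mat_def Let_def
    unfolding k_def[symmetric] G1_def[symmetric] G2_def[symmetric] G3_def[symmetric]
      G4_def[symmetric] G5_def[symmetric]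
    by (simp only: transpose_append_rows[OF G(1) c2] transpose_append_rows[OF G(2) c3]
        transpose_append_rows[OF G(3) c4] transpose_append_rows[OF G(4) G(5)])
  have tG1: "transpose_mat G1 *\<^sub>v v1 = 0\<^sub>v n @\<^sub>v 0\<^sub>v T"
    unfolding G1_def using v
    by (simp add: transpose_append_cols[of _ n n _ T] mat_mult_append[of _ n n _ T])
  have tG2: "transpose_mat G2 *\<^sub>v v2 = 0\<^sub>v n @\<^sub>v 0\<^sub>v T"
    unfolding G2_def using v
    by (simp add: transpose_append_cols[of _ k n _ T] mat_mult_append[of _ n k _ T])
  have tG3: "transpose_mat G3 *\<^sub>v y = y @\<^sub>v (transpose_mat Xd *\<^sub>v y)"
    unfolding G3_def using v Xd
    by (simp add: transpose_append_cols[of _ n n _ T] mat_mult_append[of _ n n _ T])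
  have tG4: "transpose_mat G4 *\<^sub>v z = 0\<^sub>v n @\<^sub>v - (transpose_mat X *\<^sub>v z)"
    unfolding G4_def using v X
    by (simp add: transpose_append_cols[of _ n n _ T] mat_mult_append[of _ n n _ T]
        transpose_uminus uminus_mat_mult_vec[of _ T n])
  have tG5: "transpose_mat G5 *\<^sub>v u = 0\<^sub>v n @\<^sub>v - (transpose_mat U *\<^sub>v u)"
    unfolding G5_def using v U
    by (simp add: transpose_append_cols[of _ m n _ T] mat_mult_append[of _ n m _ T]
        transpose_uminus uminus_mat_mult_vec[of _ T m])
  have "transpose_mat (data_mat n m N T Xd X U) *\<^sub>v (v1 @\<^sub>v v2 @\<^sub>v y @\<^sub>v z @\<^sub>v u) =
      transpose_mat G1 *\<^sub>v v1 + (transpose_mat G2 *\<^sub>v v2 + (transpose_mat G3 *\<^sub>v y +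
      (transpose_mat G4 *\<^sub>v z + transpose_mat G5 *\<^sub>v u)))"
    unfolding eq by (rule append_cols5_mult_vec) (use G v in simp_all)
  also have "\<dots> = y @\<^sub>v (transpose_mat Xd *\<^sub>v y - transpose_mat X *\<^sub>v z - transpose_mat U *\<^sub>v u)"
    unfolding tG1 tG2 tG3 tG4 tG5 using v X Xd U by (intro eq_vecI) auto
  finally show ?thesis .
qed

text \<open>The range of \<open>V\<close> consists of the pairs \<open>(y, W^T y)\<close>, so
  membership in the noise set makes the form of \<Phi> nonnegative on exactly these pairs.\<close>

lemma noise_form_nonneg:
  assumes W: "W \<in> noise_set n T \<Phi>" and \<Phi>: "\<Phi> \<in> carrier_mat (n + T) (n + T)"
    and y: "y \<in> carrier_vec n"
  shows "0 \<le> (y @\<^sub>v (transpose_mat W *\<^sub>v y)) \<bullet> (\<Phi> *\<^sub>v (y @\<^sub>v (transpose_mat W *\<^sub>v y)))"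
proof -
  define V where "V = 1\<^sub>m n @\<^sub>r transpose_mat W"
  have Wc: "W \<in> carrier_mat n T" and psd: "pos_semidef (transpose_mat V * \<Phi> * V)"
    using W by (auto simp: noise_set_def V_def)
  have V: "V \<in> carrier_mat (n + T) n" unfolding V_def using Wc by auto
  have Vy: "V *\<^sub>v y = y @\<^sub>v (transpose_mat W *\<^sub>v y)"
    unfolding V_def using Wc y by (simp add: mat_mult_append[of _ n n _ T])
  have "0 \<le> y \<bullet> ((transpose_mat V * \<Phi> * V) *\<^sub>v y)"
    using psd V y by (auto simp: pos_semidef_def)
  also have "(transpose_mat V * \<Phi> * V) *\<^sub>v y = transpose_mat V *\<^sub>v (\<Phi> *\<^sub>v (V *\<^sub>v y))"
    using V \<Phi> y by (simp add: assoc_mult_mat_vec[of _ n "n + T" _ n] assoc_mult_mat_vec[of _ n "n + T" _ "n + T"])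
  also have "y \<bullet> \<dots> = (V *\<^sub>v y) \<bullet> (\<Phi> *\<^sub>v (V *\<^sub>v y))"
    using transpose_vec_mult_scalar[of "transpose_mat V" n "n + T" "\<Phi> *\<^sub>v (V *\<^sub>v y)" y] V \<Phi> y by simp
  finally show ?thesis unfolding Vy .
qed

text \<open>The first two blocks of \<open>v\<close> are those that make the first two block rows of
  the product vanish, the completion of squares behind a Schur complement. The blocks
  \<open>z\<close> and \<open>u\<close> stay free: they enter only affinely and are fixed when the
  data term comes in.\<close>

lemma design_mat_form:
  fixes P L :: "nat \<Rightarrow> real mat" and \<gamma> :: "nat \<Rightarrow> real"
  assumes i: "i \<in> {1..N}" and P: "\<And>j. j \<in> {1..N} \<Longrightarrow> P j \<in> carrier_mat n n \<and> pos_def (P j)"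
    and L: "L i \<in> carrier_mat m n" and Q: "Q \<in> carrier_mat n n" "pos_def Q"
    and x: "x \<in> carrier_vec n" and z: "z \<in> carrier_vec n" and u: "u \<in> carrier_vec m"
  defines "e \<equiv> (ones_col (N - 1) \<otimes>\<^sub>K 1\<^sub>m n) *\<^sub>v x"
  defines "v \<equiv> - (Q *\<^sub>v x) @\<^sub>v - (diag_others N P i *\<^sub>v e) @\<^sub>v P i *\<^sub>v x @\<^sub>v z @\<^sub>v u"
  shows "design_mat n m N P Q \<gamma> L i \<in> carrier_mat (n + ((N - 1) * n + (n + (n + m)))) (n + ((N - 1) * n + (n + (n + m))))"
    and "v \<bullet> (design_mat n m N P Q \<gamma> L i *\<^sub>v v) =
      real (N - 1) * (x \<bullet> (P i *\<^sub>v x)) - x \<bullet> (Q *\<^sub>v x) - (\<Sum>j\<in>{1..N} - {i}. x \<bullet> (P j *\<^sub>v x))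
      - 2 * inverse (\<gamma> i) * (x \<bullet> z) - 2 * (u \<bullet> (L i *\<^sub>v (P i *\<^sub>v x)))"
proof -
  define k where "k = (N - 1) * n"
  define R where "R = minv (P i)"
  define E where "E = ones_col (N - 1) \<otimes>\<^sub>K 1\<^sub>m n"
  define S where "S = - (inverse (\<gamma> i) \<cdot>\<^sub>m R)"
  define D where "D = diag_others N P i"
  define y where "y = P i *\<^sub>v x"
  define v1 where "v1 = - (Q *\<^sub>v x)"
  define v2 where "v2 = - (D *\<^sub>v e)"
  have Pi: "P i \<in> carrier_mat n n" "pos_def (P i)" using P i by auto
  have R: "R \<in> carrier_mat n n" unfolding R_def by (rule pos_def_minv[OF Pi])
  have E: "E \<in> carrier_mat k n" unfolding E_def k_def by simp
  have S: "S \<in> carrier_mat n n" unfolding S_def using R by simp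
  have D: "D \<in> carrier_mat k k" "pos_def D"
    unfolding D_def k_def using diag_others_pos_def[OF i P] by auto
  have Qi: "minv Q \<in> carrier_mat n n" by (rule pos_def_minv[OF Q])
  have Di: "minv D \<in> carrier_mat k k" by (rule pos_def_minv[OF D])
  have e: "e \<in> carrier_vec k" and eE: "e = E *\<^sub>v x" unfolding e_def E_def[symmetric] using E x by auto
  have y: "y \<in> carrier_vec n" unfolding y_def using Pi x by simp
  have v1: "v1 \<in> carrier_vec n" unfolding v1_def using Q x by simp
  have v2: "v2 \<in> carrier_vec k" unfolding v2_def using D e by simp
  have v_eq: "v = v1 @\<^sub>v v2 @\<^sub>v y @\<^sub>v z @\<^sub>v u" unfolding v_def v1_def v2_def y_def D_def ..
  have vc: "v \<in> carrier_vec (n + (k + (n + (n + m))))"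
    unfolding v_eq using v1 v2 y z u by (intro append_carrier_vec)
  define W1 where "W1 = minv Q @\<^sub>c 0\<^sub>m n k @\<^sub>c R @\<^sub>c 0\<^sub>m n n @\<^sub>c 0\<^sub>m n m"
  define W2 where "W2 = 0\<^sub>m k n @\<^sub>c minv D @\<^sub>c E * R @\<^sub>c 0\<^sub>m k n @\<^sub>c 0\<^sub>m k m"
  define W3 where "W3 = R @\<^sub>c R * transpose_mat E @\<^sub>c real (N - 1) \<cdot>\<^sub>m R @\<^sub>c S @\<^sub>c - transpose_mat (L i)"
  define W4 where "W4 = 0\<^sub>m n n @\<^sub>c 0\<^sub>m n k @\<^sub>c S @\<^sub>c 0\<^sub>m n n @\<^sub>c 0\<^sub>m n m"
  define W5 where "W5 = 0\<^sub>m m n @\<^sub>c 0\<^sub>m m k @\<^sub>c - L i @\<^sub>c 0\<^sub>m m n @\<^sub>c 0\<^sub>m m m"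
  have blocks: "E * R \<in> carrier_mat k n" "R * transpose_mat E \<in> carrier_mat n k"
    "real (N - 1) \<cdot>\<^sub>m R \<in> carrier_mat n n" "- transpose_mat (L i) \<in> carrier_mat n m" "- L i \<in> carrier_mat m n"
    using E R L by auto
  have W: "W1 \<in> carrier_mat n (n + (k + (n + (n + m))))" "W2 \<in> carrier_mat k (n + (k + (n + (n + m))))"
    "W3 \<in> carrier_mat n (n + (k + (n + (n + m))))" "W4 \<in> carrier_mat n (n + (k + (n + (n + m))))"
    "W5 \<in> carrier_mat m (n + (k + (n + (n + m))))"
    unfolding W1_def W2_def W3_def W4_def W5_def
    using Qi Di R S blocks by (intro carrier_append_cols zero_carrier_mat; simp)+
  have des: "design_mat n m N P Q \<gamma> L i = W1 @\<^sub>r W2 @\<^sub>r W3 @\<^sub>r W4 @\<^sub>r W5"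
    unfolding design_mat_def Let_def W1_def W2_def W3_def W4_def W5_def k_def E_def S_def R_def D_def ..
  show "design_mat n m N P Q \<gamma> L i \<in> carrier_mat (n + ((N - 1) * n + (n + (n + m)))) (n + ((N - 1) * n + (n + (n + m))))"
    unfolding des using W unfolding k_def by (intro carrier_append_rows)
  have Ry: "R *\<^sub>v y = x" unfolding R_def y_def by (rule minv_mult_cancel[OF Pi x])
  have Sy: "S *\<^sub>v y = - (inverse (\<gamma> i) \<cdot>\<^sub>v x)"
    unfolding S_def using R y by (simp add: uminus_mat_mult_vec[of _ n n] smult_mat_mult_vec[of _ n n] Ry)
  have Sz: "S *\<^sub>v z = - (inverse (\<gamma> i) \<cdot>\<^sub>v (R *\<^sub>v z))"
    unfolding S_def using R z by (simp add: uminus_mat_mult_vec[of _ n n] smult_mat_mult_vec[of _ n n])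
  have Qv1: "minv Q *\<^sub>v v1 = - x"
    unfolding v1_def using Q x Qi minv_mult_cancel[OF Q x] by (simp add: mult_mat_uminus_vec[of _ n n])
  have Dv2: "minv D *\<^sub>v v2 = - e"
    unfolding v2_def using D e Di minv_mult_cancel[OF D e] by (simp add: mult_mat_uminus_vec[of _ k k])
  have W1v: "W1 *\<^sub>v v = 0\<^sub>v n"
  proof -
    have "W1 *\<^sub>v v = minv Q *\<^sub>v v1 + (0\<^sub>m n k *\<^sub>v v2 + (R *\<^sub>v y + (0\<^sub>m n n *\<^sub>v z + 0\<^sub>m n m *\<^sub>v u)))"
      unfolding W1_def v_eq
      by (rule append_cols5_mult_vec) (use Qi R v1 v2 y z u in auto)
    then show ?thesis unfolding Qv1 Ry using x v1 v2 z u by auto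
  qed
  have W2v: "W2 *\<^sub>v v = 0\<^sub>v k"
  proof -
    have "W2 *\<^sub>v v = 0\<^sub>m k n *\<^sub>v v1 + (minv D *\<^sub>v v2 + ((E * R) *\<^sub>v y + (0\<^sub>m k n *\<^sub>v z + 0\<^sub>m k m *\<^sub>v u)))"
      unfolding W2_def v_eq
      by (rule append_cols5_mult_vec) (use Di blocks v1 v2 y z u in auto)
    moreover have "(E * R) *\<^sub>v y = e" using E R y Ry eE by simp
    ultimately show ?thesis unfolding Dv2 using e v1 v2 z u by auto
  qed
  have W3v: "W3 *\<^sub>v v = R *\<^sub>v v1 + (R *\<^sub>v (transpose_mat E *\<^sub>v v2) + (real (N - 1) \<cdot>\<^sub>v x +
      (- (inverse (\<gamma> i) \<cdot>\<^sub>v (R *\<^sub>v z)) + - (transpose_mat (L i) *\<^sub>v u))))"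
  proof -
    have "W3 *\<^sub>v v = R *\<^sub>v v1 + ((R * transpose_mat E) *\<^sub>v v2 + ((real (N - 1) \<cdot>\<^sub>m R) *\<^sub>v y +
        (S *\<^sub>v z + (- transpose_mat (L i)) *\<^sub>v u)))"
      unfolding W3_def v_eq
      by (rule append_cols5_mult_vec) (use R S blocks v1 v2 y z u in auto)
    moreover have "(R * transpose_mat E) *\<^sub>v v2 = R *\<^sub>v (transpose_mat E *\<^sub>v v2)"
      by (rule assoc_mult_mat_vec) (use R E v2 in auto)
    moreover have "(real (N - 1) \<cdot>\<^sub>m R) *\<^sub>v y = real (N - 1) \<cdot>\<^sub>v x"
      using R y Ry by (simp add: smult_mat_mult_vec[of _ n n])
    moreover have "(- transpose_mat (L i)) *\<^sub>v u = - (transpose_mat (L i) *\<^sub>v u)"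
      by (rule uminus_mat_mult_vec) (use L u in auto)
    ultimately show ?thesis unfolding Sz by simp
  qed
  have W4v: "W4 *\<^sub>v v = - (inverse (\<gamma> i) \<cdot>\<^sub>v x)"
  proof -
    have "W4 *\<^sub>v v = 0\<^sub>m n n *\<^sub>v v1 + (0\<^sub>m n k *\<^sub>v v2 + (S *\<^sub>v y + (0\<^sub>m n n *\<^sub>v z + 0\<^sub>m n m *\<^sub>v u)))"
      unfolding W4_def v_eq
      by (rule append_cols5_mult_vec) (use S v1 v2 y z u in auto)
    then show ?thesis unfolding Sy using x v1 v2 z u by auto
  qed
  have W5v: "W5 *\<^sub>v v = - (L i *\<^sub>v y)"
  proof -
    have "W5 *\<^sub>v v = 0\<^sub>m m n *\<^sub>v v1 + (0\<^sub>m m k *\<^sub>v v2 + ((- L i) *\<^sub>v y + (0\<^sub>m m n *\<^sub>v z + 0\<^sub>m m m *\<^sub>v u)))"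
      unfolding W5_def v_eq
      by (rule append_cols5_mult_vec) (use blocks v1 v2 y z u in auto)
    then show ?thesis using v1 v2 z u y L by (auto simp: uminus_mat_mult_vec[of _ m n])
  qed
  \<comment> \<open>The inverse in the third block row cancels against the third block
    \<open>P i x\<close> of the vector.\<close>
  have yR: "y \<bullet> (R *\<^sub>v w) = x \<bullet> w" if w: "w \<in> carrier_vec n" for w
    unfolding y_def R_def using pos_def_symmetric[OF Pi x, of "minv (P i) *\<^sub>v w"]
      minv_mult_cancel(2)[OF Pi w] R w by (simp add: R_def)
  have form_v2: "x \<bullet> (transpose_mat E *\<^sub>v v2) = - (\<Sum>j\<in>{1..N} - {i}. x \<bullet> (P j *\<^sub>v x))"
  proof -
    have "x \<bullet> (transpose_mat E *\<^sub>v v2) = (E *\<^sub>v x) \<bullet> v2"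
      using transpose_vec_mult_scalar[of "transpose_mat E" n k v2 x] E x v2 by simp
    also have "\<dots> = - (e \<bullet> (D *\<^sub>v e))"
      unfolding eE[symmetric] v2_def using D e by (simp add: scalar_prod_uminus[of _ k])
    finally show ?thesis
      using diag_others_form_ones[OF i P x] unfolding e_def D_def by simp
  qed
  have yL: "y \<bullet> (transpose_mat (L i) *\<^sub>v u) = u \<bullet> (L i *\<^sub>v y)"
    using transpose_vec_mult_scalar[OF L y u] comm_scalar_prod[of y n "transpose_mat (L i) *\<^sub>v u"] L y u
    by simp
  \<comment> \<open>Only the last three block rows contribute. The terms in \<open>z\<close> and
    \<open>u\<close> occur in the third row and again in the fourth or fifth, whence the factors
    2.\<close>
  have "v \<bullet> (design_mat n m N P Q \<gamma> L i *\<^sub>v v) = v \<bullet> (W1 *\<^sub>v v @\<^sub>v W2 *\<^sub>v v @\<^sub>v W3 *\<^sub>v v @\<^sub>v W4 *\<^sub>v v @\<^sub>v W5 *\<^sub>v v)"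
    unfolding des append_rows5_mult_vec[OF W vc] ..
  also have "\<dots> = v1 \<bullet> (W1 *\<^sub>v v) + (v2 \<bullet> (W2 *\<^sub>v v) + (y \<bullet> (W3 *\<^sub>v v) + (z \<bullet> (W4 *\<^sub>v v) + u \<bullet> (W5 *\<^sub>v v))))"
    by (subst (1) v_eq, rule scalar_prod_append5) (use W vc v1 v2 y z u in auto)
  also have "v1 \<bullet> (W1 *\<^sub>v v) = 0" unfolding W1v using v1 by simp
  also have "v2 \<bullet> (W2 *\<^sub>v v) = 0" unfolding W2v using v2 by simp
  also have "y \<bullet> (W3 *\<^sub>v v) = x \<bullet> v1 + (x \<bullet> (transpose_mat E *\<^sub>v v2) + (real (N - 1) * (y \<bullet> x) +
      (- (inverse (\<gamma> i) * (x \<bullet> z)) + - (y \<bullet> (transpose_mat (L i) *\<^sub>v u)))))"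
    unfolding W3v using R v1 v2 E z u L x y
    by (simp add: scalar_prod_add_distrib[of _ n] yR scalar_prod_uminus[of _ n])
  also have "z \<bullet> (W4 *\<^sub>v v) = - (inverse (\<gamma> i) * (x \<bullet> z))"
    unfolding W4v using x z comm_scalar_prod[OF x z] by (simp add: scalar_prod_uminus[of _ n])
  also have "u \<bullet> (W5 *\<^sub>v v) = - (u \<bullet> (L i *\<^sub>v y))"
    unfolding W5v using u L y by (simp add: scalar_prod_uminus[of _ m])
  also have "x \<bullet> v1 = - (x \<bullet> (Q *\<^sub>v x))"
    unfolding v1_def using Q x by (simp add: scalar_prod_uminus[of _ n])
  also have "y \<bullet> x = x \<bullet> (P i *\<^sub>v x)"
    unfolding y_def by (rule pos_def_symmetric[OF Pi x x])
  finally show "v \<bullet> (design_mat n m N P Q \<gamma> L i *\<^sub>v v) =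
      real (N - 1) * (x \<bullet> (P i *\<^sub>v x)) - x \<bullet> (Q *\<^sub>v x) - (\<Sum>j\<in>{1..N} - {i}. x \<bullet> (P j *\<^sub>v x))
      - 2 * inverse (\<gamma> i) * (x \<bullet> z) - 2 * (u \<bullet> (L i *\<^sub>v (P i *\<^sub>v x)))"
    unfolding form_v2 yL y_def[symmetric] by simp
qed

text \<open>For the blocks \<open>A^T y\<close> and \<open>B^T y\<close> the model part of the data
  cancels, whatever the unknown matrices are. What remains is the noise, the only part with a known
  bound.\<close>

lemma transpose_data_residual:
  fixes A :: "real mat"
  assumes A: "A \<in> carrier_mat n n" and B: "B \<in> carrier_mat n m" and X: "X \<in> carrier_mat n T"
    and U: "U \<in> carrier_mat m T" and W: "W \<in> carrier_mat n T" and y: "y \<in> carrier_vec n"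
  shows "transpose_mat (A * X + B * U + W) *\<^sub>v y - transpose_mat X *\<^sub>v (transpose_mat A *\<^sub>v y)
    - transpose_mat U *\<^sub>v (transpose_mat B *\<^sub>v y) = transpose_mat W *\<^sub>v y"
proof -
  have AX: "A * X \<in> carrier_mat n T" and BU: "B * U \<in> carrier_mat n T" using A B X U by auto
  have t: "transpose_mat (A * X + B * U + W) = transpose_mat (A * X) + transpose_mat (B * U) + transpose_mat W"
    using AX BU W by (simp add: transpose_add[of _ n T])
  have "transpose_mat (A * X + B * U + W) *\<^sub>v y =
      transpose_mat (A * X) *\<^sub>v y + transpose_mat (B * U) *\<^sub>v y + transpose_mat W *\<^sub>v y"
  proof -
    have c: "transpose_mat (A * X) \<in> carrier_mat T n" "transpose_mat (B * U) \<in> carrier_mat T n"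
      "transpose_mat W \<in> carrier_mat T n"
      using AX BU W by auto
    show ?thesis
      unfolding t add_mult_distrib_mat_vec[OF add_carrier_mat[OF c(2)] c(3) y]
        add_mult_distrib_mat_vec[OF c(1,2) y] ..
  qed
  also have "transpose_mat (A * X) *\<^sub>v y = transpose_mat X *\<^sub>v (transpose_mat A *\<^sub>v y)"
    unfolding transpose_mult[OF A X] by (rule assoc_mult_mat_vec) (use A X y in auto)
  also have "transpose_mat (B * U) *\<^sub>v y = transpose_mat U *\<^sub>v (transpose_mat B *\<^sub>v y)"
    unfolding transpose_mult[OF B U] by (rule assoc_mult_mat_vec) (use B U y in auto)
  finally show ?thesis using A B X U W y by (intro eq_vecI) auto
qed

lemma form_of_congruence:
  fixes G :: "real mat"
  assumes G: "G \<in> carrier_mat r c" and \<Phi>: "\<Phi> \<in> carrier_mat c c" and v: "v \<in> carrier_vec r"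
  shows "v \<bullet> ((G * \<Phi> * transpose_mat G) *\<^sub>v v) = (transpose_mat G *\<^sub>v v) \<bullet> (\<Phi> *\<^sub>v (transpose_mat G *\<^sub>v v))"
proof -
  have "(G * \<Phi> * transpose_mat G) *\<^sub>v v = (G * \<Phi>) *\<^sub>v (transpose_mat G *\<^sub>v v)"
    by (rule assoc_mult_mat_vec) (use G \<Phi> v in auto)
  also have "\<dots> = G *\<^sub>v (\<Phi> *\<^sub>v (transpose_mat G *\<^sub>v v))"
    by (rule assoc_mult_mat_vec) (use G \<Phi> v in auto)
  also have "v \<bullet> \<dots> = (transpose_mat G *\<^sub>v v) \<bullet> (\<Phi> *\<^sub>v (transpose_mat G *\<^sub>v v))"
    by (rule transpose_vec_mult_scalar[symmetric]) (use G \<Phi> v in auto)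
  finally show ?thesis .
qed

text \<open>
  The matrix inequality is tested with the vector of blocks \<open>-Q x\<close>, \<open>-P\<^sub>j x\<close> (\<open>j \<noteq> i\<close>), \<open>P\<^sub>i x\<close>,
  \<open>A\<^sup>T P\<^sub>i x\<close>, \<open>B\<^sup>T P\<^sub>i x\<close>. The first two blocks perform a Schur complement, and the last three are mapped by
  the transposed data matrix to \<open>(P\<^sub>i x, W\<^sup>T P\<^sub>i x)\<close>, where the noise bound applies.
\<close>

lemma vdot_mode_field_le:
  fixes A B P L :: "nat \<Rightarrow> real mat" and \<gamma> :: "nat \<Rightarrow> real"
  assumes i: "i \<in> {1..N}" and P: "\<And>j. j \<in> {1..N} \<Longrightarrow> P j \<in> carrier_mat n n \<and> pos_def (P j)"
    and A: "A i \<in> carrier_mat n n" and B: "B i \<in> carrier_mat n m" and L: "L i \<in> carrier_mat m n"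
    and X: "X \<in> carrier_mat n T" and U: "U \<in> carrier_mat m T"
    and \<Phi>: "\<Phi> \<in> carrier_mat (n + T) (n + T)" and W: "W \<in> noise_set n T \<Phi>"
    and Xd: "Xd = A i * X + B i * U + W"
    and \<alpha>: "0 \<le> \<alpha>" and \<gamma>: "0 < \<gamma> i" and Q: "Q \<in> carrier_mat n n" "pos_def Q"
    and lmi: "pos_semidef (design_mat n m N P Q \<gamma> L i
        - \<alpha> \<cdot>\<^sub>m (data_mat n m N T Xd X U * \<Phi> * transpose_mat (data_mat n m N T Xd X U)))"
    and x: "x \<in> carrier_vec n"
  shows "vdot (P i) x (mode_field A B (gain \<gamma> L P) i x)
    \<le> - \<gamma> i * (x \<bullet> (Q *\<^sub>v x) + (\<Sum>j\<in>{1..N} - {i}. x \<bullet> (P j *\<^sub>v x) - x \<bullet> (P i *\<^sub>v x)))"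
proof -
  define k where "k = (N - 1) * n"
  define r where "r = n + (k + (n + (n + m)))"
  define y where "y = P i *\<^sub>v x"
  define z where "z = transpose_mat (A i) *\<^sub>v y"
  define u where "u = transpose_mat (B i) *\<^sub>v y"
  define e where "e = (ones_col (N - 1) \<otimes>\<^sub>K 1\<^sub>m n) *\<^sub>v x"
  define v where "v = - (Q *\<^sub>v x) @\<^sub>v - (diag_others N P i *\<^sub>v e) @\<^sub>v P i *\<^sub>v x @\<^sub>v z @\<^sub>v u"
  define G where "G = data_mat n m N T Xd X U"
  define D where "D = design_mat n m N P Q \<gamma> L i"
  have Pi: "P i \<in> carrier_mat n n" "pos_def (P i)" using P i by auto
  have y: "y \<in> carrier_vec n" unfolding y_def using Pi x by simp
  have z: "z \<in> carrier_vec n" unfolding z_def using A y by simp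
  have u: "u \<in> carrier_vec m" unfolding u_def using B y by simp
  have Wc: "W \<in> carrier_mat n T" using W by (simp add: noise_set_def)
  have Xdc: "Xd \<in> carrier_mat n T" unfolding Xd using A B X U Wc by simp
  have e: "e \<in> carrier_vec k"
    unfolding e_def k_def using carrier_ones_kronecker x by (metis mult_mat_vec_carrier)
  have Dg: "diag_others N P i \<in> carrier_mat k k" unfolding k_def by (rule diag_others_pos_def[OF i P])
  have v1: "- (Q *\<^sub>v x) \<in> carrier_vec n" and v2: "- (diag_others N P i *\<^sub>v e) \<in> carrier_vec k"
    using Q x Dg e by auto
  have v: "v \<in> carrier_vec r"
    unfolding v_def r_def using v1 v2 y z u unfolding y_def by (intro append_carrier_vec)
  have D: "D \<in> carrier_mat r r"
    unfolding D_def r_def k_def by (rule design_mat_form(1)[where i = i and L = L, OF i P L Q x z u])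
  have G: "G \<in> carrier_mat r (n + T)"
    unfolding G_def data_mat_def Let_def r_def k_def using X Xdc U
    by (intro carrier_append_rows carrier_append_cols) auto
  have S: "\<alpha> \<cdot>\<^sub>m (G * \<Phi> * transpose_mat G) \<in> carrier_mat r r" using G \<Phi> by auto
  have Gv: "transpose_mat G *\<^sub>v v = y @\<^sub>v (transpose_mat W *\<^sub>v y)"
    unfolding G_def v_def y_def[symmetric]
    using data_mat_transpose_mult_vec[OF X Xdc U v1 v2[unfolded k_def] y z u]
      transpose_data_residual[OF A B X U Wc y]
    by (simp add: z_def u_def Xd)
  have "0 \<le> v \<bullet> ((D - \<alpha> \<cdot>\<^sub>m (G * \<Phi> * transpose_mat G)) *\<^sub>v v)"
    using lmi v D G \<Phi> unfolding D_def[symmetric] G_def[symmetric] by (auto simp: pos_semidef_def)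
  also have "\<dots> = v \<bullet> (D *\<^sub>v v) - \<alpha> * (v \<bullet> ((G * \<Phi> * transpose_mat G) *\<^sub>v v))"
  proof -
    have GG: "G * \<Phi> * transpose_mat G \<in> carrier_mat r r" using G \<Phi> by auto
    then show ?thesis
      unfolding minus_mat_mult_vec[OF D S v] smult_mat_mult_vec[OF GG v]
      using D v by (simp add: scalar_prod_minus_right[of _ r])
  qed
  \<comment> \<open>At this vector the subtracted data term is a nonnegative multiple of the noise
    form.\<close>
  also have "\<dots> \<le> v \<bullet> (D *\<^sub>v v)"
    unfolding form_of_congruence[OF G \<Phi> v] Gv using noise_form_nonneg[OF W \<Phi> y] \<alpha> by simp
  also have "\<dots> = real (N - 1) * (x \<bullet> (P i *\<^sub>v x)) - x \<bullet> (Q *\<^sub>v x) - (\<Sum>j\<in>{1..N} - {i}. x \<bullet> (P j *\<^sub>v x))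
      - 2 * inverse (\<gamma> i) * (x \<bullet> z) - 2 * (u \<bullet> (L i *\<^sub>v y))"
    unfolding D_def v_def e_def y_def by (rule design_mat_form(2)[where i = i and L = L, OF i P L Q x z u])
  \<comment> \<open>The coefficient \<open>N - 1\<close> is the number of modes other than
    \<open>i\<close>, so each of them is paired with one copy of the form of
    \<open>P i\<close>.\<close>
  finally have "2 * inverse (\<gamma> i) * (x \<bullet> z) + 2 * (u \<bullet> (L i *\<^sub>v y)) \<le>
      - (x \<bullet> (Q *\<^sub>v x) + (\<Sum>j\<in>{1..N} - {i}. x \<bullet> (P j *\<^sub>v x) - x \<bullet> (P i *\<^sub>v x)))"
    using i by (simp add: sum_subtractf)
  \<comment> \<open>The gain carries the factor \<gamma> i, whereas the matrix inequality puts its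
    inverse on the drift term; one multiplication turns the left side into the closed-loop
    derivative.\<close>
  then have "\<gamma> i * (2 * inverse (\<gamma> i) * (x \<bullet> z) + 2 * (u \<bullet> (L i *\<^sub>v y))) \<le>
      \<gamma> i * - (x \<bullet> (Q *\<^sub>v x) + (\<Sum>j\<in>{1..N} - {i}. x \<bullet> (P j *\<^sub>v x) - x \<bullet> (P i *\<^sub>v x)))"
    using \<gamma> by (intro mult_left_mono) auto
  moreover have "\<gamma> i * (2 * inverse (\<gamma> i) * (x \<bullet> z) + 2 * (u \<bullet> (L i *\<^sub>v y)))
      = 2 * (x \<bullet> z) + 2 * \<gamma> i * (u \<bullet> (L i *\<^sub>v y))"
    using \<gamma> by (simp add: field_simps)
  moreover have "vdot (P i) x (mode_field A B (gain \<gamma> L P) i x) = 2 * (x \<bullet> z) + 2 * \<gamma> i * (u \<bullet> (L i *\<^sub>v y))"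
  proof -
    define \<xi> where "\<xi> = mode_field A B (gain \<gamma> L P) i x"
    have LP: "L i * P i \<in> carrier_mat m n" using L Pi by auto
    have K: "gain \<gamma> L P i \<in> carrier_mat m n" unfolding gain_def using LP by simp
    have Kx: "gain \<gamma> L P i *\<^sub>v x = \<gamma> i \<cdot>\<^sub>v (L i *\<^sub>v y)"
      unfolding gain_def smult_mat_mult_vec[OF LP x] y_def using L Pi x by simp
    have Ly: "L i *\<^sub>v y \<in> carrier_vec m" using L y by simp
    have "\<xi> = A i *\<^sub>v x + B i *\<^sub>v (gain \<gamma> L P i *\<^sub>v x)"
      unfolding \<xi>_def mode_field_def using A B K x by (simp add: add_mult_distrib_mat_vec[of _ n n])
    then have \<xi>: "\<xi> = A i *\<^sub>v x + \<gamma> i \<cdot>\<^sub>v (B i *\<^sub>v (L i *\<^sub>v y))"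
      unfolding Kx mult_mat_vec[OF B Ly] .
    have \<xi>c: "\<xi> \<in> carrier_vec n" unfolding \<xi> using A B Ly x by simp
    have "vdot (P i) x \<xi> = 2 * (y \<bullet> \<xi>)"
      using pos_def_symmetric[OF Pi x \<xi>c] comm_scalar_prod[OF \<xi>c y] by (simp add: vdot_def y_def)
    also have "y \<bullet> \<xi> = y \<bullet> (A i *\<^sub>v x) + \<gamma> i * (y \<bullet> (B i *\<^sub>v (L i *\<^sub>v y)))"
      unfolding \<xi> using y A B Ly x by (simp add: scalar_prod_add_distrib[of _ n])
    also have "y \<bullet> (A i *\<^sub>v x) = x \<bullet> z"
      using transpose_vec_mult_scalar[OF A x y] comm_scalar_prod[OF x z] by (simp add: z_def)
    also have "y \<bullet> (B i *\<^sub>v (L i *\<^sub>v y)) = u \<bullet> (L i *\<^sub>v y)"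
      using transpose_vec_mult_scalar[OF B Ly y] by (simp add: u_def)
    finally show ?thesis unfolding \<xi>_def by simp
  qed
  ultimately show ?thesis by (simp only: mult_minus_left mult_minus_right)
qed

section \<open>Dissipation along solutions\<close>

lemma switching_minimizes:
  assumes "1 \<le> N"
  shows "switching N P y \<in> {1..N}"
    and "j \<in> {1..N} \<Longrightarrow> y \<bullet> (P (switching N P y) *\<^sub>v y) \<le> y \<bullet> (P j *\<^sub>v y)"
proof -
  let ?f = "\<lambda>i. y \<bullet> (P i *\<^sub>v y)"
  let ?S = "{i. is_arg_min ?f (\<lambda>i. i \<in> {1..N}) i}"
  have "finite ?S" by (rule finite_subset[of _ "{1..N}"]) (auto simp: is_arg_min_def)
  moreover have "?S \<noteq> {}"
    using ex_is_arg_min_if_finite[of "{1..N}" ?f] assms by auto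
  ultimately have "switching N P y \<in> ?S" unfolding switching_def by (rule Min_in)
  then show "switching N P y \<in> {1..N}"
    and "j \<in> {1..N} \<Longrightarrow> ?f (switching N P y) \<le> ?f j"
    by (auto simp: is_arg_min_linorder)
qed

lemma Min_form_eq_switching:
  assumes "1 \<le> N"
  shows "Min ((\<lambda>i. y \<bullet> (P i *\<^sub>v y)) ` {1..N}) = y \<bullet> (P (switching N P y) *\<^sub>v y)"
  by (rule Min_eqI) (use switching_minimizes[OF assms] in auto)

text \<open>Where forms tie, \<open>switching\<close> names only one minimizer, but other modes can
  be active and receive weight. An active mode is selected at points arbitrarily close to
  \<open>y\<close>, and its minimality there survives the limit.\<close>

lemma active_mode_minimizes:
  assumes N: "1 \<le> N" and P: "\<And>j. j \<in> {1..N} \<Longrightarrow> P j \<in> carrier_mat n n"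
    and y: "y \<in> carrier_vec n" and i: "i \<in> active_modes n N (switching N P) y" and j: "j \<in> {1..N}"
  shows "y \<bullet> (P i *\<^sub>v y) \<le> y \<bullet> (P j *\<^sub>v y)"
proof -
  have iN: "i \<in> {1..N}" using i by (simp add: active_modes_def)
  define M where "M = eucl_norm y + 1"
  have M: "0 \<le> M" by (simp add: M_def)
  obtain C where C: "0 \<le> C"
    "\<And>y z. \<lbrakk>y \<in> carrier_vec n; z \<in> carrier_vec n; \<And>k. k < n \<Longrightarrow> \<bar>y $ k\<bar> \<le> M; \<And>k. k < n \<Longrightarrow> \<bar>z $ k\<bar> \<le> M\<rbrakk>
      \<Longrightarrow> \<bar>y \<bullet> (P i *\<^sub>v y) - z \<bullet> (P i *\<^sub>v z)\<bar> \<le> C * eucl_norm (y - z)"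
    using quadratic_form_Lipschitz[OF P[OF iN] M] by blast
  obtain D where D: "0 \<le> D"
    "\<And>y z. \<lbrakk>y \<in> carrier_vec n; z \<in> carrier_vec n; \<And>k. k < n \<Longrightarrow> \<bar>y $ k\<bar> \<le> M; \<And>k. k < n \<Longrightarrow> \<bar>z $ k\<bar> \<le> M\<rbrakk>
      \<Longrightarrow> \<bar>y \<bullet> (P j *\<^sub>v y) - z \<bullet> (P j *\<^sub>v z)\<bar> \<le> D * eucl_norm (y - z)"
    using quadratic_form_Lipschitz[OF P[OF j] M] by blast
  have "y \<bullet> (P i *\<^sub>v y) \<le> y \<bullet> (P j *\<^sub>v y) + e" if e: "0 < e" for e
  proof -
    \<comment> \<open>The 1 keeps \<open>z\<close> inside the box, which is why \<open>M\<close>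
      exceeds the norm of \<open>y\<close> by 1; the quotient makes the two Lipschitz errors add up
      to at most \<open>e\<close>.\<close>
    define \<epsilon> where "\<epsilon> = min 1 (e / (C + D + 1))"
    have "0 < \<epsilon>" using e C(1) D(1) by (simp add: \<epsilon>_def)
    then obtain z where z: "z \<in> carrier_vec n" "eucl_norm (z - y) < \<epsilon>" "switching N P z = i"
      using i unfolding active_modes_def by blast
    have My: "\<bar>y $ k\<bar> \<le> M" if "k < n" for k
      using component_le_eucl_norm[of k y] that y by (simp add: M_def)
    have Mz: "\<bar>z $ k\<bar> \<le> M" if "k < n" for k
    proof -
      have "\<bar>z $ k - y $ k\<bar> \<le> eucl_norm (z - y)"
        using component_le_eucl_norm[of k "z - y"] that y z by simp
      moreover have "\<bar>y $ k\<bar> \<le> eucl_norm y" using component_le_eucl_norm[of k y] that y by simp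
      moreover have "eucl_norm (z - y) < 1" using z(2) by (simp add: \<epsilon>_def)
      ultimately show ?thesis unfolding M_def by linarith
    qed
    have "\<bar>z \<bullet> (P i *\<^sub>v z) - y \<bullet> (P i *\<^sub>v y)\<bar> \<le> C * eucl_norm (z - y)"
      by (rule C(2)) (use y z My Mz in auto)
    moreover have "\<bar>z \<bullet> (P j *\<^sub>v z) - y \<bullet> (P j *\<^sub>v y)\<bar> \<le> D * eucl_norm (z - y)"
      by (rule D(2)) (use y z My Mz in auto)
    moreover have "z \<bullet> (P i *\<^sub>v z) \<le> z \<bullet> (P j *\<^sub>v z)"
      using switching_minimizes(2)[OF N j, of z P] z(3) by simp
    moreover have "(C + D) * eucl_norm (z - y) \<le> e"
    proof -
      have "(C + D) * eucl_norm (z - y) \<le> (C + D + 1) * (e / (C + D + 1))"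
        using z(2) C(1) D(1) by (intro mult_mono) (auto simp: \<epsilon>_def)
      then show ?thesis using C(1) D(1) by simp
    qed
    ultimately show ?thesis by (simp add: distrib_right)
  qed
  then show ?thesis by (rule field_le_epsilon)
qed

lemma vdot_smult:
  assumes "P \<in> carrier_mat n n" "x \<in> carrier_vec n" "\<xi> \<in> carrier_vec n"
  shows "vdot P x (c \<cdot>\<^sub>v \<xi>) = c * vdot P x \<xi>"
  using assms mult_mat_vec[OF assms(1,3)] by (simp add: vdot_def distrib_left)

section \<open>Quadratic forms along an absolutely continuous curve\<close>

lemma quadratic_form_has_derivative:
  fixes P :: "real mat"
  assumes P: "P \<in> carrier_mat n n" and x: "\<And>s. s \<in> S \<Longrightarrow> x s \<in> carrier_vec n"
    and t: "t \<in> S" and d: "d \<in> carrier_vec n" and dx: "has_vec_deriv x d (at t within S)"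
  shows "((\<lambda>s. x s \<bullet> (P *\<^sub>v x s)) has_real_derivative vdot P (x t) d) (at t within S)"
proof -
  have "((\<lambda>s. \<Sum>i<n. \<Sum>j<n. P $$ (i, j) * (x s $ i * x s $ j)) has_real_derivative
      (\<Sum>i<n. \<Sum>j<n. P $$ (i, j) * (d $ i * x t $ j + d $ j * x t $ i))) (at t within S)"
    using dx d unfolding has_vec_deriv_def
    by (intro DERIV_sum DERIV_cmult DERIV_mult) auto
  also have "(\<Sum>i<n. \<Sum>j<n. P $$ (i, j) * (d $ i * x t $ j + d $ j * x t $ i)) = vdot P (x t) d"
    unfolding vdot_def scalar_prod_mult_mat_vec[OF P x[OF t] d] scalar_prod_mult_mat_vec[OF P d x[OF t]]
      sum.distrib[symmetric]
    by (intro sum.cong refl) (simp add: algebra_simps)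
  finally show ?thesis
    \<comment> \<open>The radius 1 is arbitrary: the form and its double sum agree on all of
      \<open>S\<close>.\<close>
    by (rule has_field_derivative_transform_within[where d = 1])
      (simp_all add: t scalar_prod_mult_mat_vec[OF P x x])
qed

lemma abs_cont_on_component_continuous:
  assumes "abs_cont_on S x" "\<And>s. s \<in> S \<Longrightarrow> x s \<in> carrier_vec n" "k < n"
  shows "continuous_on S (\<lambda>s. x s $ k)"
proof (rule abs_cont_real_imp_continuous_on, rule abs_cont_real_dominated[OF assms(1), of 1])
  fix s t assume "s \<in> S" "t \<in> S" "s \<le> t"
  then show "\<bar>x t $ k - x s $ k\<bar> \<le> 1 * eucl_norm (x t - x s) + 1 * (t - s)"
    using component_le_eucl_norm[of k "x t - x s"] assms(2,3) by fastforce
qed simp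

lemma quadratic_form_continuous_on:
  fixes P :: "real mat"
  assumes P: "P \<in> carrier_mat n n" and ac: "abs_cont_on S x" and x: "\<And>s. s \<in> S \<Longrightarrow> x s \<in> carrier_vec n"
  shows "continuous_on S (\<lambda>s. x s \<bullet> (P *\<^sub>v x s))"
proof -
  have "continuous_on S (\<lambda>s. \<Sum>i<n. \<Sum>j<n. P $$ (i, j) * (x s $ i * x s $ j))"
    using abs_cont_on_component_continuous[OF ac x] by (intro continuous_intros) auto
  then show ?thesis
    by (rule continuous_on_eq) (simp add: scalar_prod_mult_mat_vec[OF P x x])
qed

text \<open>On a compact interval the curve stays in a box, where every form is Lipschitz; a minimum
  of finitely many such functions keeps a common constant.\<close>

lemma Min_form_Lipschitz_along:
  fixes N :: nat
  assumes N: "1 \<le> N" and P: "\<And>j. j \<in> {1..N} \<Longrightarrow> P j \<in> carrier_mat n n"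
    and ac: "abs_cont_on {a..b} x" and x: "\<And>s. s \<in> {a..b} \<Longrightarrow> x s \<in> carrier_vec n"
  obtains C where "0 \<le> C"
    "\<And>s t. s \<in> {a..b} \<Longrightarrow> t \<in> {a..b} \<Longrightarrow>
      \<bar>Min ((\<lambda>i. x t \<bullet> (P i *\<^sub>v x t)) ` {1..N}) - Min ((\<lambda>i. x s \<bullet> (P i *\<^sub>v x s)) ` {1..N})\<bar>
        \<le> C * eucl_norm (x t - x s)"
proof -
  have "\<exists>B. \<forall>s\<in>{a..b}. \<bar>x s $ k\<bar> \<le> B" if "k < n" for k
  proof -
    have "compact ((\<lambda>s. x s $ k) ` {a..b})"
      by (rule compact_continuous_image[OF abs_cont_on_component_continuous[OF ac x that]]) auto
    then have "bounded ((\<lambda>s. x s $ k) ` {a..b})" by (rule compact_imp_bounded)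
    then show ?thesis by (auto simp: bounded_iff)
  qed
  then obtain Bd where Bd: "\<And>k s. k < n \<Longrightarrow> s \<in> {a..b} \<Longrightarrow> \<bar>x s $ k\<bar> \<le> Bd k" by metis
  define M where "M = (\<Sum>k<n. \<bar>Bd k\<bar>)"
  have M: "0 \<le> M" unfolding M_def by (rule sum_nonneg) simp
  have BM: "\<bar>x s $ k\<bar> \<le> M" if "k < n" "s \<in> {a..b}" for k s
  proof -
    have "\<bar>Bd k\<bar> \<le> M" unfolding M_def using that by (intro member_le_sum) auto
    then show ?thesis using Bd[OF that] by simp
  qed
  have "\<exists>C\<ge>0. \<forall>s\<in>{a..b}. \<forall>t\<in>{a..b}.
      \<bar>x t \<bullet> (P i *\<^sub>v x t) - x s \<bullet> (P i *\<^sub>v x s)\<bar> \<le> C * eucl_norm (x t - x s)" if i: "i \<in> {1..N}" for i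
    using quadratic_form_Lipschitz[OF P[OF i] M] x BM by metis
  then obtain c where c: "\<And>i. i \<in> {1..N} \<Longrightarrow> 0 \<le> c i"
    "\<And>i s t. i \<in> {1..N} \<Longrightarrow> s \<in> {a..b} \<Longrightarrow> t \<in> {a..b} \<Longrightarrow>
      \<bar>x t \<bullet> (P i *\<^sub>v x t) - x s \<bullet> (P i *\<^sub>v x s)\<bar> \<le> c i * eucl_norm (x t - x s)" by metis
  define C where "C = sum c {1..N}"
  have C: "\<bar>x t \<bullet> (P i *\<^sub>v x t) - x s \<bullet> (P i *\<^sub>v x s)\<bar> \<le> C * eucl_norm (x t - x s)"
    if "i \<in> {1..N}" "s \<in> {a..b}" "t \<in> {a..b}" for i s t
  proof -
    have "c i \<le> C" unfolding C_def using that c(1) by (intro member_le_sum) auto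
    then have "c i * eucl_norm (x t - x s) \<le> C * eucl_norm (x t - x s)"
      by (rule mult_right_mono) simp
    then show ?thesis using c(2)[OF that] by linarith
  qed
  show ?thesis
  proof (rule that[of C])
    show "0 \<le> C" unfolding C_def by (rule sum_nonneg) (use c in auto)
    fix s t assume s: "s \<in> {a..b}" and t: "t \<in> {a..b}"
    note sw = switching_minimizes[OF N]
    show "\<bar>Min ((\<lambda>i. x t \<bullet> (P i *\<^sub>v x t)) ` {1..N}) - Min ((\<lambda>i. x s \<bullet> (P i *\<^sub>v x s)) ` {1..N})\<bar>
        \<le> C * eucl_norm (x t - x s)"
      \<comment> \<open>Each minimum is compared with the form that is minimal at the other time,
        which bounds the difference in both directions.\<close>
      unfolding Min_form_eq_switching[OF N]
      using C[OF sw(1)[of P "x s"] s t] C[OF sw(1)[of P "x t"] s t]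
        sw(2)[OF sw(1)[of P "x s"], of "x t" P] sw(2)[OF sw(1)[of P "x t"], of "x s" P]
      by linarith
  qed
qed

text \<open>
  The minimum of the forms need not be differentiable along the curve, but it is touched from above by the form
  of the selected mode, which bounds its upper right Dini derivative.
\<close>

lemma Min_form_dissipation:
  assumes N: "1 \<le> N" and P: "\<And>j. j \<in> {1..N} \<Longrightarrow> P j \<in> carrier_mat n n" and Q: "Q \<in> carrier_mat n n"
    and x: "\<And>s. 0 \<le> s \<Longrightarrow> x s \<in> carrier_vec n" and ac: "abs_cont_on {0..c} x" and a: "0 \<le> a" "a \<le> c"
    and ae: "AE t in lebesgue. 0 \<le> t \<longrightarrow> (\<exists>d\<in>carrier_vec n. has_vec_deriv x d (at t within {0..}) \<and>
      vdot (P (switching N P (x t))) (x t) d \<le> - (x t \<bullet> (Q *\<^sub>v x t)))"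
  defines "V \<equiv> \<lambda>y. Min ((\<lambda>i. y \<bullet> (P i *\<^sub>v y)) ` {1..N})"
  shows "V (x c) + integral {a..c} (\<lambda>s. x s \<bullet> (Q *\<^sub>v x s)) \<le> V (x a)"
proof -
  have c: "0 \<le> c" using a by simp
  define q where "q s = x s \<bullet> (Q *\<^sub>v x s)" for s
  \<comment> \<open>Adding the cost accumulated so far turns the dissipation inequality into
    monotonicity of one function.\<close>
  define f where "f s = V (x s) + integral {0..s} q" for s
  have q: "continuous_on {0..c} q"
    unfolding q_def using quadratic_form_continuous_on[OF Q ac] x by simp
  have "bounded (q ` {0..c})"
    using compact_imp_bounded compact_continuous_image[OF q] by blast
  then obtain K where K: "\<And>s. s \<in> {0..c} \<Longrightarrow> \<bar>q s\<bar> \<le> K" unfolding bounded_iff by fastforce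
  then have "\<bar>q 0\<bar> \<le> K" using c by simp
  then have K0: "0 \<le> K" by linarith
  obtain C where C: "0 \<le> C"
    "\<And>s t. s \<in> {0..c} \<Longrightarrow> t \<in> {0..c} \<Longrightarrow> \<bar>V (x t) - V (x s)\<bar> \<le> C * eucl_norm (x t - x s)"
    unfolding V_def using Min_form_Lipschitz_along[where P = P, OF N P ac] x by auto
  have "abs_cont_real {a..c} f"
  proof (rule abs_cont_real_subset)
    show "abs_cont_real {0..c} f"
    proof (rule abs_cont_real_dominated[OF ac, of "C + K"])
      show "0 \<le> C + K" using C K0 by simp
      fix s t assume st: "s \<in> {0..c}" "t \<in> {0..c}" "s \<le> t"
      have qs: "q integrable_on {s..t}" and q0: "q integrable_on {0..t}"
        using st by (auto intro!: integrable_continuous_real continuous_on_subset[OF q])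
      have "integral {0..s} q + integral {s..t} q = integral {0..t} q"
        using st q0 by (intro Henstock_Kurzweil_Integration.integral_combine) auto
      moreover have "norm (integral {s..t} q) \<le> K * (t - s)"
        by (rule integral_bound) (use st K in \<open>auto intro: continuous_on_subset[OF q]\<close>)
      moreover have "\<bar>V (x t) - V (x s)\<bar> \<le> C * eucl_norm (x t - x s)" using C(2) st by blast
      moreover have "0 \<le> K * eucl_norm (x t - x s)" "0 \<le> C * (t - s)" using K0 C(1) st by auto
      ultimately show "\<bar>f t - f s\<bar> \<le> (C + K) * eucl_norm (x t - x s) + (C + K) * (t - s)"
        unfolding f_def distrib_right real_norm_def by linarith
    qed
  qed (use a in auto)
  moreover have "AE t in lebesgue. a \<le> t \<and> t < c \<longrightarrow>
      (\<forall>\<epsilon>>0. \<forall>\<^sub>F s in at_right t. f s - f t \<le> \<epsilon> * (s - t))"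
    using ae
  proof eventually_elim
    case (elim t)
    show ?case
    proof (intro impI allI)
      fix \<epsilon> :: real assume "a \<le> t \<and> t < c" and \<epsilon>: "0 < \<epsilon>"
      then have t: "0 \<le> t \<and> t < c" using a by simp
      define \<sigma> where "\<sigma> = switching N P (x t)"
      have \<sigma>: "\<sigma> \<in> {1..N}" unfolding \<sigma>_def by (rule switching_minimizes(1)[OF N])
      obtain d where d: "d \<in> carrier_vec n" "has_vec_deriv x d (at t within {0..})"
        "vdot (P \<sigma>) (x t) d \<le> - q t"
        using elim t unfolding \<sigma>_def q_def by blast
      \<comment> \<open>The mode selected at time \<open>t\<close> is frozen. Then \<open>f\<close>
        lies below \<open>g\<close> and equals it at \<open>t\<close>, so right difference quotients
        of \<open>f\<close> are at most those of \<open>g\<close>, even if the selection changes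
        right after \<open>t\<close>.\<close>
      define g where "g s = x s \<bullet> (P \<sigma> *\<^sub>v x s) + integral {0..s} q" for s
      have D1: "((\<lambda>s. x s \<bullet> (P \<sigma> *\<^sub>v x s)) has_real_derivative vdot (P \<sigma>) (x t) d) (at t within {0..c})"
        by (rule DERIV_subset[OF quadratic_form_has_derivative[OF P[OF \<sigma>] x _ d(1,2)]]) (use t in auto)
      have D2: "((\<lambda>s. integral {0..s} q) has_real_derivative q t) (at t within {0..c})"
        by (rule integral_has_real_derivative[OF q]) (use t in auto)
      have "(g has_real_derivative vdot (P \<sigma>) (x t) d + q t) (at t within {0..c})"
        unfolding g_def by (rule DERIV_add[OF D1 D2])
      then have "((\<lambda>s. (g s - g t) / (s - t)) \<longlongrightarrow> vdot (P \<sigma>) (x t) d + q t) (at t within {0..c})"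
        by (simp add: has_field_derivative_iff)
      moreover have "vdot (P \<sigma>) (x t) d + q t < \<epsilon>" using d(3) \<epsilon> by linarith
      ultimately have "\<forall>\<^sub>F s in at t within {0..c}. (g s - g t) / (s - t) < \<epsilon>"
        by (rule order_tendstoD(2))
      \<comment> \<open>To the right of \<open>t\<close> the denominator is positive, so the bound
        on the quotient can be multiplied out.\<close>
      then have "\<forall>\<^sub>F s in at t within {t..c}. (g s - g t) / (s - t) < \<epsilon>"
        by (rule filter_leD[OF at_le, rotated]) (use t in auto)
      then have "\<forall>\<^sub>F s in at_right t. (g s - g t) / (s - t) < \<epsilon>"
        using t by (simp add: at_within_Icc_at_right)
      moreover have "\<forall>\<^sub>F s in at_right t. t < s" by (rule eventually_at_right_less)
      ultimately show "\<forall>\<^sub>F s in at_right t. f s - f t \<le> \<epsilon> * (s - t)"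
      proof eventually_elim
        case (elim s)
        have "g s - g t \<le> \<epsilon> * (s - t)" using elim by (simp add: divide_less_eq)
        moreover have "V (x s) \<le> x s \<bullet> (P \<sigma> *\<^sub>v x s)" unfolding V_def using \<sigma> by (intro Min_le) auto
        moreover have "V (x t) = x t \<bullet> (P \<sigma> *\<^sub>v x t)"
          unfolding V_def \<sigma>_def by (rule Min_form_eq_switching[OF N])
        ultimately show ?case unfolding f_def g_def by linarith
      qed
    qed
  qed
  ultimately have "f c \<le> f a" by (intro abs_cont_real_Dini_nonincreasing[OF _ a(2)])
  moreover have "integral {0..a} q + integral {a..c} q = integral {0..c} q"
    using a integrable_continuous_real[OF q] by (intro Henstock_Kurzweil_Integration.integral_combine) auto
  ultimately show ?thesis unfolding f_def q_def[symmetric] by simp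
qed

section \<open>Cost and stability from integrated dissipation\<close>

text \<open>Monotone convergence along truncations at integer times. Integrability belongs to the
  claim, since \<open>integral\<close> is 0 for a function that is not integrable and the inequality
  alone would then say nothing about the cost.\<close>

lemma nonneg_continuous_integral_halfline_le:
  fixes q :: "real \<Rightarrow> real"
  assumes cont: "\<And>c. 0 \<le> c \<Longrightarrow> continuous_on {0..c} q" and nonneg: "\<And>t. 0 \<le> t \<Longrightarrow> 0 \<le> q t"
    and bound: "\<And>c. 0 \<le> c \<Longrightarrow> integral {0..c} q \<le> K"
  shows "q integrable_on {0..} \<and> integral {0..} q \<le> K"
proof -
  define f where "f k t = (if t \<in> {0..real k} then q t else 0)" for k :: nat and t
  have qk: "q integrable_on {0..real k}" for k
    by (rule integrable_continuous_real) (simp add: cont)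
  have fi: "f k integrable_on {0..}" and If: "integral {0..} (f k) = integral {0..real k} q" for k
    unfolding f_def using qk[of k] integrable_restrict_Int[of "{0..real k}" q "{0..}"]
      integral_restrict_Int[of "{0..}" "{0..real k}" q]
    by (simp_all add: Int_absorb2 Int_commute)
  have "q integrable_on {0..} \<and> (\<lambda>k. integral {0..} (f k)) \<longlonglongrightarrow> integral {0..} q"
  proof (rule monotone_convergence_increasing[OF fi])
    fix k t assume "t \<in> {0::real..}"
    then show "f k t \<le> f (Suc k) t" using nonneg by (auto simp: f_def)
  next
    fix t :: real assume t: "t \<in> {0..}"
    have "\<forall>\<^sub>F k in sequentially. f k t = q t"
      using eventually_ge_at_top[of "nat \<lceil>t\<rceil>"] by eventually_elim (use t in \<open>auto simp: f_def nat_le_iff ceiling_le_iff\<close>)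
    then show "(\<lambda>k. f k t) \<longlonglongrightarrow> q t" by (rule tendsto_eventually)
  next
    have "0 \<le> integral {0..real k} q" for k
      by (rule integral_nonneg[OF qk]) (use nonneg in auto)
    then show "bounded (range (\<lambda>k. integral {0..} (f k)))"
      unfolding If bounded_iff using bound[of "real _"] by (intro exI[of _ K]) auto
  qed
  moreover have "integral {0..} (f k) \<le> K" for k unfolding If by (rule bound) simp
  ultimately show ?thesis by (meson LIMSEQ_le_const2)
qed

text \<open>Only an integrated inequality is assumed, so no differential inequality is solved: the
  cost on \<open>{0..t}\<close> is at least \<open>t\<close> times a multiple of
  \<open>V (x t)\<close>, and at most \<open>V (x 0)\<close>.\<close>

lemma globally_asymptotically_stable_quadratic:
  fixes V q :: "real vec \<Rightarrow> real"
  assumes a: "0 < a" and b: "0 < b" and c: "0 < c"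
    and Va: "\<And>y. y \<in> carrier_vec n \<Longrightarrow> a * (y \<bullet> y) \<le> V y"
    and Vb: "\<And>y. y \<in> carrier_vec n \<Longrightarrow> V y \<le> b * (y \<bullet> y)"
    and qc: "\<And>y. y \<in> carrier_vec n \<Longrightarrow> c * (y \<bullet> y) \<le> q y"
    and sols: "\<And>x t. x \<in> sols \<Longrightarrow> 0 \<le> t \<Longrightarrow> x t \<in> carrier_vec n"
    and cont: "\<And>x t. x \<in> sols \<Longrightarrow> 0 \<le> t \<Longrightarrow> continuous_on {0..t} (\<lambda>s. q (x s))"
    and diss: "\<And>x s t. x \<in> sols \<Longrightarrow> 0 \<le> s \<Longrightarrow> s \<le> t \<Longrightarrow> V (x t) + integral {s..t} (\<lambda>s. q (x s)) \<le> V (x s)"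
  shows "globally_asymptotically_stable sols"
proof -
  have mono: "V (x t) \<le> V (x s)" if x: "x \<in> sols" and st: "0 \<le> s" "s \<le> t" for x s t
  proof -
    have "0 \<le> integral {s..t} (\<lambda>s. q (x s))"
    proof (rule integral_nonneg)
      show "(\<lambda>s. q (x s)) integrable_on {s..t}"
        by (rule integrable_continuous_real, rule continuous_on_subset[OF cont[OF x, of t]]) (use st in auto)
      fix r assume "r \<in> {s..t}"
      then have "x r \<in> carrier_vec n" using sols[OF x] st by simp
      then show "0 \<le> q (x r)"
        using qc[of "x r"] c scalar_prod_self_nonneg[of "x r"]
        by (meson mult_nonneg_nonneg less_imp_le order_trans)
    qed
    then show ?thesis using diss[OF x st] by linarith
  qed
  show ?thesis
    unfolding globally_asymptotically_stable_def
  proof (intro conjI allI impI ballI)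
    fix \<epsilon> :: real assume \<epsilon>: "0 < \<epsilon>"
    \<comment> \<open>Chosen so that \<open>b * \<delta>\<^sup>2 = a * \<epsilon>\<^sup>2\<close>,
      which balances the two quadratic bounds of \<open>V\<close>.\<close>
    define \<delta> where "\<delta> = sqrt (a / b) * \<epsilon>"
    show "\<exists>\<delta>>0. \<forall>x\<in>sols. eucl_norm (x 0) < \<delta> \<longrightarrow> (\<forall>t\<ge>0. eucl_norm (x t) < \<epsilon>)"
    proof (intro exI[of _ \<delta>] conjI ballI impI allI)
      show "0 < \<delta>" using a b \<epsilon> by (simp add: \<delta>_def)
      fix x and t :: real assume x: "x \<in> sols" and x0: "eucl_norm (x 0) < \<delta>" and t: "0 \<le> t"
      have "a * (eucl_norm (x t))\<^sup>2 \<le> V (x t)" using Va[OF sols[OF x t]] by (simp add: eucl_norm_square)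
      also have "\<dots> \<le> V (x 0)" by (rule mono[OF x _ t]) simp
      also have "\<dots> \<le> b * (eucl_norm (x 0))\<^sup>2" using Vb[OF sols[OF x]] by (simp add: eucl_norm_square)
      also have "\<dots> < b * \<delta>\<^sup>2" using x0 b by (simp add: power_strict_mono)
      also have "\<dots> = a * \<epsilon>\<^sup>2" using a b by (simp add: \<delta>_def power_mult_distrib)
      finally have "(eucl_norm (x t))\<^sup>2 < \<epsilon>\<^sup>2" using a by simp
      then show "eucl_norm (x t) < \<epsilon>" using \<epsilon> by (simp add: power_less_imp_less_base)
    qed
  next
    fix x assume x: "x \<in> sols"
    \<comment> \<open>The constant left over when \<open>t * (c / b) * a\<close> times the squared
      norm at \<open>t\<close> is bounded by \<open>V (x 0)\<close>.\<close>
    define C where "C = V (x 0) * b / (a * c)"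
    have bound: "eucl_norm (x t) \<le> sqrt (C / t)" if t: "0 < t" for t
    proof -
      \<comment> \<open>The final value of \<open>V\<close> bounds the running cost from below at
        all earlier times, because \<open>V\<close> does not increase and both are comparable to the
        squared norm.\<close>
      have ge: "c / b * V (x t) \<le> q (x s)" if s: "s \<in> {0..t}" for s
      proof -
        have xs: "x s \<in> carrier_vec n" using sols[OF x] s by simp
        have "V (x t) \<le> b * (x s \<bullet> x s)" using mono[OF x, of s t] Vb[OF xs] s by simp
        then have "c / b * V (x t) \<le> c / b * (b * (x s \<bullet> x s))"
          by (rule mult_left_mono) (use b c in simp)
        also have "\<dots> = c * (x s \<bullet> x s)" using b by simp
        finally show ?thesis using qc[OF xs] by linarith
      qed
      have "t * (c / b * V (x t)) = integral {0..t} (\<lambda>s. c / b * V (x t))" using t by simp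
      also have "\<dots> \<le> integral {0..t} (\<lambda>s. q (x s))"
        by (rule integral_le) (use ge t cont[OF x, of t] in \<open>auto intro: integrable_continuous_real\<close>)
      also have "\<dots> \<le> V (x 0)"
      proof -
        have xt: "x t \<in> carrier_vec n" using sols[OF x] t by simp
        have "0 \<le> V (x t)"
          using Va[OF xt] a scalar_prod_self_nonneg[of "x t"] by (meson mult_nonneg_nonneg less_imp_le order_trans)
        then show ?thesis using diss[OF x, of 0 t] t by simp
      qed
      finally have "t * (c / b * V (x t)) \<le> V (x 0)" .
      moreover have "t * (c / b * (a * (x t \<bullet> x t))) \<le> t * (c / b * V (x t))"
        using Va[OF sols[OF x]] t b c by (intro mult_left_mono) auto
      ultimately have "t * (c / b * (a * (x t \<bullet> x t))) \<le> V (x 0)" by linarith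
      then have "x t \<bullet> x t \<le> C / t"
        unfolding C_def using a b c t by (simp add: field_simps)
      then show ?thesis unfolding eucl_norm_def by simp
    qed
    have "((\<lambda>t. sqrt (C / t)) \<longlongrightarrow> sqrt 0) at_top"
      by (intro tendsto_real_sqrt tendsto_divide_0[OF tendsto_const] filterlim_at_top_imp_at_infinity filterlim_ident)
    then have lim: "((\<lambda>t. sqrt (C / t)) \<longlongrightarrow> 0) at_top" by simp
    show "((\<lambda>t. eucl_norm (x t)) \<longlongrightarrow> 0) at_top"
    proof (rule tendsto_sandwich[OF _ _ tendsto_const lim])
      show "\<forall>\<^sub>F t in at_top. eucl_norm (x t) \<le> sqrt (C / t)"
        using eventually_gt_at_top[of 0] by eventually_elim (rule bound)
    qed simp
  qed
qed

text \<open>The second condition of the solution concept replaces the selected form along the mixed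
  direction by each active form along its own field. There the rate is known, and since the weights
  sum to one it passes through the average unchanged.\<close>

lemma closed_loop_descent:
  fixes A B P K :: "nat \<Rightarrow> real mat" and \<sigma> :: "real vec \<Rightarrow> nat"
  assumes x: "x \<in> closed_loop_solutions n N A B P K \<sigma>"
    and P: "\<And>i. i \<in> {1..N} \<Longrightarrow> P i \<in> carrier_mat n n"
    and field: "\<And>i y. i \<in> {1..N} \<Longrightarrow> y \<in> carrier_vec n \<Longrightarrow> mode_field A B K i y \<in> carrier_vec n"
    and descent: "\<And>i y. y \<in> carrier_vec n \<Longrightarrow> i \<in> active_modes n N \<sigma> y \<Longrightarrow>
      vdot (P i) y (mode_field A B K i y) \<le> - q y"
  shows "AE t in lebesgue. 0 \<le> t \<longrightarrow> (\<exists>d\<in>carrier_vec n. has_vec_deriv x d (at t within {0..}) \<and>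
      vdot (P (\<sigma> (x t))) (x t) d \<le> - q (x t))"
proof -
  have xc: "\<And>t. 0 \<le> t \<Longrightarrow> x t \<in> carrier_vec n" using x by (simp add: closed_loop_solutions_def)
  have "AE t in lebesgue. 0 \<le> t \<longrightarrow>
       (\<exists>w :: nat \<Rightarrow> real.
          let J = active_modes n N \<sigma> (x t);
              \<xi> = (\<lambda>i. mode_field A B K i (x t));
              d = finsum_vec TYPE(real) n (\<lambda>i. w i \<cdot>\<^sub>v \<xi> i) J
          in (\<forall>i\<in>J. 0 \<le> w i) \<and> (\<Sum>i\<in>J. w i) = 1 \<and>
             has_vec_deriv x d (at t within {0..}) \<and>
             vdot (P (\<sigma> (x t))) (x t) d \<le> (\<Sum>i\<in>J. vdot (P i) (x t) (w i \<cdot>\<^sub>v \<xi> i)))"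
    using x unfolding closed_loop_solutions_def by blast
  then show ?thesis
  proof eventually_elim
    case (elim t)
    show ?case
    proof
      assume t: "0 \<le> t"
      define J where "J = active_modes n N \<sigma> (x t)"
      define \<xi> where "\<xi> i = mode_field A B K i (x t)" for i
      obtain w :: "nat \<Rightarrow> real" where w: "\<And>i. i \<in> J \<Longrightarrow> 0 \<le> w i" "(\<Sum>i\<in>J. w i) = 1"
        and dx: "has_vec_deriv x (finsum_vec TYPE(real) n (\<lambda>i. w i \<cdot>\<^sub>v \<xi> i) J) (at t within {0..})"
        and le: "vdot (P (\<sigma> (x t))) (x t) (finsum_vec TYPE(real) n (\<lambda>i. w i \<cdot>\<^sub>v \<xi> i) J)
          \<le> (\<Sum>i\<in>J. vdot (P i) (x t) (w i \<cdot>\<^sub>v \<xi> i))"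
        using elim t unfolding Let_def J_def \<xi>_def by blast
      have J: "J \<subseteq> {1..N}" by (auto simp: J_def active_modes_def)
      have \<xi>: "\<xi> i \<in> carrier_vec n" if "i \<in> J" for i
        unfolding \<xi>_def using field that J xc[OF t] by blast
      have "(\<Sum>i\<in>J. vdot (P i) (x t) (w i \<cdot>\<^sub>v \<xi> i)) \<le> (\<Sum>i\<in>J. w i * - q (x t))"
      proof (rule sum_mono)
        fix i assume i: "i \<in> J"
        then have "vdot (P i) (x t) (\<xi> i) \<le> - q (x t)"
          unfolding \<xi>_def using descent[OF xc[OF t]] by (simp add: J_def)
        then have "w i * vdot (P i) (x t) (\<xi> i) \<le> w i * - q (x t)"
          using w(1)[OF i] by (rule mult_left_mono)
        moreover have "vdot (P i) (x t) (w i \<cdot>\<^sub>v \<xi> i) = w i * vdot (P i) (x t) (\<xi> i)"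
          using vdot_smult P i J xc[OF t] \<xi>[OF i] by blast
        ultimately show "vdot (P i) (x t) (w i \<cdot>\<^sub>v \<xi> i) \<le> w i * - q (x t)" by simp
      qed
      also have "\<dots> = - q (x t)" unfolding sum_distrib_right[symmetric] w(2) by simp
      finally have "(\<Sum>i\<in>J. vdot (P i) (x t) (w i \<cdot>\<^sub>v \<xi> i)) \<le> - q (x t)" .
      moreover have "finsum_vec TYPE(real) n (\<lambda>i. w i \<cdot>\<^sub>v \<xi> i) J \<in> carrier_vec n"
        by (rule finsum_vec_closed) (use \<xi> in auto)
      ultimately show "\<exists>d\<in>carrier_vec n. has_vec_deriv x d (at t within {0..}) \<and>
          vdot (P (\<sigma> (x t))) (x t) d \<le> - q (x t)"
        using dx le by fastforce
    qed
  qed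
qed

lemma Min_form_bounds:
  fixes P :: "nat \<Rightarrow> real mat"
  assumes N: "1 \<le> N" and P: "\<And>j. j \<in> {1..N} \<Longrightarrow> P j \<in> carrier_mat n n \<and> pos_def (P j)"
  obtains a b where "0 < a" "0 < b"
    "\<And>y. y \<in> carrier_vec n \<Longrightarrow> a * (y \<bullet> y) \<le> Min ((\<lambda>i. y \<bullet> (P i *\<^sub>v y)) ` {1..N})"
    "\<And>y. y \<in> carrier_vec n \<Longrightarrow> Min ((\<lambda>i. y \<bullet> (P i *\<^sub>v y)) ` {1..N}) \<le> b * (y \<bullet> y)"
proof -
  have "\<exists>a>0. \<forall>y\<in>carrier_vec n. a * (y \<bullet> y) \<le> y \<bullet> (P i *\<^sub>v y)" if "i \<in> {1..N}" for i
    using pos_def_form_ge[of "P i" n] P[OF that] by metis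
  then obtain a where a: "\<And>i. i \<in> {1..N} \<Longrightarrow> 0 < a i"
    "\<And>i y. i \<in> {1..N} \<Longrightarrow> y \<in> carrier_vec n \<Longrightarrow> a i * (y \<bullet> y) \<le> y \<bullet> (P i *\<^sub>v y)" by metis
  \<comment> \<open>Any single mode bounds the minimum from above; mode 1 exists because
    \<open>N\<close> is at least 1.\<close>
  have P1: "P 1 \<in> carrier_mat n n" using P N by simp
  obtain b where b: "0 < b" "\<And>y. y \<in> carrier_vec n \<Longrightarrow> y \<bullet> (P 1 *\<^sub>v y) \<le> b * (y \<bullet> y)"
    using quadratic_form_le[OF P1] by blast
  show ?thesis
  proof (rule that[of "Min (a ` {1..N})" b])
    show "0 < Min (a ` {1..N})" using N a(1) by (subst Min_gr_iff) auto
    fix y :: "real vec" assume y: "y \<in> carrier_vec n"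
    have "Min (a ` {1..N}) * (y \<bullet> y) \<le> y \<bullet> (P i *\<^sub>v y)" if i: "i \<in> {1..N}" for i
    proof -
      have "Min (a ` {1..N}) * (y \<bullet> y) \<le> a i * (y \<bullet> y)"
        using i scalar_prod_self_nonneg by (intro mult_right_mono Min_le) auto
      then show ?thesis using a(2)[OF i y] by linarith
    qed
    then show "Min (a ` {1..N}) * (y \<bullet> y) \<le> Min ((\<lambda>i. y \<bullet> (P i *\<^sub>v y)) ` {1..N})"
      using N by (subst Min_ge_iff) auto
    have "Min ((\<lambda>i. y \<bullet> (P i *\<^sub>v y)) ` {1..N}) \<le> y \<bullet> (P 1 *\<^sub>v y)" using N by (intro Min_le) auto
    then show "Min ((\<lambda>i. y \<bullet> (P i *\<^sub>v y)) ` {1..N}) \<le> b * (y \<bullet> y)" using b(2)[OF y] by linarith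
  qed (rule b(1))
qed

theorem theorem2:
  fixes n m N :: nat and T :: "nat \<Rightarrow> nat"
    and A B X Xd U W \<Phi> \<Phi>11 \<Phi>12 \<Phi>22 P L :: "nat \<Rightarrow> real mat" and Qb :: "real mat"
    and \<alpha> \<gamma> :: "nat \<Rightarrow> real"
  assumes "1 \<le> N"
    and "\<And>i. i \<in> {1..N} \<Longrightarrow> A i \<in> carrier_mat n n"
    and "\<And>i. i \<in> {1..N} \<Longrightarrow> B i \<in> carrier_mat n m"
    and "\<And>i. i \<in> {1..N} \<Longrightarrow> X i \<in> carrier_mat n (T i)"
    and "\<And>i. i \<in> {1..N} \<Longrightarrow> Xd i \<in> carrier_mat n (T i)"
    and "\<And>i. i \<in> {1..N} \<Longrightarrow> U i \<in> carrier_mat m (T i)"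
    and "\<And>i. i \<in> {1..N} \<Longrightarrow> \<Phi>11 i \<in> carrier_mat n n"
    and "\<And>i. i \<in> {1..N} \<Longrightarrow> \<Phi>12 i \<in> carrier_mat n (T i)"
    and "\<And>i. i \<in> {1..N} \<Longrightarrow> \<Phi>22 i \<in> carrier_mat (T i) (T i)"
    and "\<And>i. i \<in> {1..N} \<Longrightarrow>
           \<Phi> i = four_block_mat (\<Phi>11 i) (\<Phi>12 i) (transpose_mat (\<Phi>12 i)) (\<Phi>22 i)"
    and "\<And>i. i \<in> {1..N} \<Longrightarrow> transpose_mat (\<Phi> i) = \<Phi> i"
    and "\<And>i. i \<in> {1..N} \<Longrightarrow> pos_def (- \<Phi>22 i)"
    and "\<And>i. i \<in> {1..N} \<Longrightarrow> W i \<in> noise_set n (T i) (\<Phi> i)"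
    and "\<And>i. i \<in> {1..N} \<Longrightarrow> Xd i = A i * X i + B i * U i + W i"
    and "\<And>i. i \<in> {1..N} \<Longrightarrow> P i \<in> carrier_mat n n \<and> pos_def (P i)"
    and "\<And>i. i \<in> {1..N} \<Longrightarrow> 0 \<le> \<alpha> i"
    and "\<And>i. i \<in> {1..N} \<Longrightarrow> 0 < \<gamma> i"
    and "\<And>i. i \<in> {1..N} \<Longrightarrow> L i \<in> carrier_mat m n"
    and "Qb \<in> carrier_mat n n" and "pos_def Qb"
    and "\<And>i. i \<in> {1..N} \<Longrightarrow>
           pos_semidef (design_mat n m N P Qb \<gamma> L i
             - \<alpha> i \<cdot>\<^sub>m (data_mat n m N (T i) (Xd i) (X i) (U i) * \<Phi> i
                       * transpose_mat (data_mat n m N (T i) (Xd i) (X i) (U i))))"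
  shows "globally_asymptotically_stable
           (closed_loop_solutions n N A B P (gain \<gamma> L P) (switching N P)) \<and>
         (\<forall>x \<in> closed_loop_solutions n N A B P (gain \<gamma> L P) (switching N P).
           (\<lambda>t. x t \<bullet> ((Min (\<gamma> ` {1..N}) \<cdot>\<^sub>m Qb) *\<^sub>v x t)) integrable_on {0..} \<and>
           integral {0..} (\<lambda>t. x t \<bullet> ((Min (\<gamma> ` {1..N}) \<cdot>\<^sub>m Qb) *\<^sub>v x t))
             \<le> Min ((\<lambda>i. x 0 \<bullet> (P i *\<^sub>v x 0)) ` {1..N}))"
proof -
  note N = assms(1) and A = assms(2) and B = assms(3) and X = assms(4) and U = assms(6)
    and \<Phi>11 = assms(7) and \<Phi>22 = assms(9) and \<Phi> = assms(10) and W = assms(13) and Xd = assms(14)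
    and P = assms(15) and \<alpha> = assms(16) and \<gamma> = assms(17) and L = assms(18) and Q = assms(19,20)
    and lmi = assms(21)
  define g where "g = Min (\<gamma> ` {1..N})"
  define V where "V y = Min ((\<lambda>i. y \<bullet> (P i *\<^sub>v y)) ` {1..N})" for y
  define q where "q y = y \<bullet> ((g \<cdot>\<^sub>m Qb) *\<^sub>v y)" for y
  define sols where "sols = closed_loop_solutions n N A B P (gain \<gamma> L P) (switching N P)"
  have Pc: "\<And>i. i \<in> {1..N} \<Longrightarrow> P i \<in> carrier_mat n n" using P by blast
  have g: "0 < g" unfolding g_def using N \<gamma> by (subst Min_gr_iff) auto
  have gQ: "g \<cdot>\<^sub>m Qb \<in> carrier_mat n n" using Q by simp
  have q: "q y = g * (y \<bullet> (Qb *\<^sub>v y))" if y: "y \<in> carrier_vec n" for y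
    unfolding q_def smult_mat_mult_vec[OF Q(1) y] using Q y by simp
  obtain c0 where c0: "0 < c0" "\<And>y. y \<in> carrier_vec n \<Longrightarrow> c0 * (y \<bullet> y) \<le> y \<bullet> (Qb *\<^sub>v y)"
    using pos_def_form_ge[OF Q] by blast
  have qc: "g * c0 * (y \<bullet> y) \<le> q y" if y: "y \<in> carrier_vec n" for y
    unfolding q[OF y] mult.assoc using c0(2)[OF y] g by (intro mult_left_mono) auto
  have Q_nonneg: "0 \<le> y \<bullet> (Qb *\<^sub>v y)" if y: "y \<in> carrier_vec n" for y
    using c0(2)[OF y] c0(1) scalar_prod_self_nonneg[of y]
    by (meson mult_nonneg_nonneg less_imp_le order_trans)
  obtain a b where ab: "0 < a" "0 < b" "\<And>y. y \<in> carrier_vec n \<Longrightarrow> a * (y \<bullet> y) \<le> V y"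
    "\<And>y. y \<in> carrier_vec n \<Longrightarrow> V y \<le> b * (y \<bullet> y)"
    unfolding V_def using Min_form_bounds[where P = P, OF N P] by blast
  have field: "mode_field A B (gain \<gamma> L P) i y \<in> carrier_vec n" if "i \<in> {1..N}" "y \<in> carrier_vec n" for i y
    unfolding mode_field_def gain_def
    using A[OF that(1)] B[OF that(1)] L[OF that(1)] Pc[OF that(1)] that(2)
    by (intro mult_mat_vec_carrier[of _ n n] add_carrier_mat mult_carrier_mat smult_carrier_mat) auto
  have descent: "vdot (P i) y (mode_field A B (gain \<gamma> L P) i y) \<le> - q y"
    if y: "y \<in> carrier_vec n" and act: "i \<in> active_modes n N (switching N P) y" for i y
  proof -
    have i: "i \<in> {1..N}" using act by (simp add: active_modes_def)
    have \<Phi>i: "\<Phi> i \<in> carrier_mat (n + T i) (n + T i)"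
      unfolding \<Phi>[OF i] using \<Phi>11[OF i] \<Phi>22[OF i] by (rule four_block_carrier_mat)
    have "0 \<le> (\<Sum>j\<in>{1..N} - {i}. y \<bullet> (P j *\<^sub>v y) - y \<bullet> (P i *\<^sub>v y))"
      by (rule sum_nonneg) (use active_mode_minimizes[where P = P, OF N Pc y act] in auto)
    then have "y \<bullet> (Qb *\<^sub>v y) \<le> y \<bullet> (Qb *\<^sub>v y) + (\<Sum>j\<in>{1..N} - {i}. y \<bullet> (P j *\<^sub>v y) - y \<bullet> (P i *\<^sub>v y))"
      by simp
    \<comment> \<open>Passing to the least factor is possible because the form of \<open>Qb\<close>
      is nonnegative; the resulting rate is common to all active modes, as the averaging over
      weights requires.\<close>
    moreover have "g \<le> \<gamma> i" unfolding g_def using i by (intro Min_le) auto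
    ultimately have "q y \<le> \<gamma> i * (y \<bullet> (Qb *\<^sub>v y) + (\<Sum>j\<in>{1..N} - {i}. y \<bullet> (P j *\<^sub>v y) - y \<bullet> (P i *\<^sub>v y)))"
      unfolding q[OF y] using Q_nonneg[OF y] \<gamma>[OF i] by (intro mult_mono) auto
    moreover have "vdot (P i) y (mode_field A B (gain \<gamma> L P) i y)
        \<le> - \<gamma> i * (y \<bullet> (Qb *\<^sub>v y) + (\<Sum>j\<in>{1..N} - {i}. y \<bullet> (P j *\<^sub>v y) - y \<bullet> (P i *\<^sub>v y)))"
      by (rule vdot_mode_field_le[where A = A and B = B and L = L and P = P and \<gamma> = \<gamma>,
            OF i P A[OF i] B[OF i] L[OF i] X[OF i] U[OF i] \<Phi>i W[OF i] Xd[OF i] \<alpha>[OF i] \<gamma>[OF i] Q lmi[OF i] y])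
    ultimately show ?thesis by (simp only: mult_minus_left)
  qed
  have xc: "x t \<in> carrier_vec n" if "x \<in> sols" "0 \<le> t" for x t
    using that by (simp add: sols_def closed_loop_solutions_def)
  have ac: "abs_cont_on {0..t} x" if "x \<in> sols" "0 \<le> t" for x t
    using that by (simp add: sols_def closed_loop_solutions_def)
  have cont: "continuous_on {0..t} (\<lambda>s. q (x s))" if "x \<in> sols" "0 \<le> t" for x t
    unfolding q_def using quadratic_form_continuous_on[OF gQ ac[OF that]] xc[OF that(1)] by simp
  have diss: "V (x t) + integral {s..t} (\<lambda>s. q (x s)) \<le> V (x s)"
    if x: "x \<in> sols" and st: "0 \<le> s" "s \<le> t" for x s t
    unfolding V_def q_def
  proof (rule Min_form_dissipation[where P = P, OF N Pc gQ xc[OF x] ac[OF x] st])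
    show "0 \<le> t" using st by simp
    show "AE t in lebesgue. 0 \<le> t \<longrightarrow> (\<exists>d\<in>carrier_vec n. has_vec_deriv x d (at t within {0..}) \<and>
        vdot (P (switching N P (x t))) (x t) d \<le> - (x t \<bullet> ((g \<cdot>\<^sub>m Qb) *\<^sub>v x t)))"
      unfolding q_def[symmetric]
      by (rule closed_loop_descent[where P = P, OF x[unfolded sols_def] Pc field descent])
  qed
  have gc: "0 < g * c0" using g c0(1) by simp
  have "globally_asymptotically_stable sols"
    by (rule globally_asymptotically_stable_quadratic[where V = V and q = q and n = n, OF ab(1,2) gc])
      (fact ab(3) ab(4) qc xc cont diss)+
  moreover have "(\<lambda>t. q (x t)) integrable_on {0..} \<and> integral {0..} (\<lambda>t. q (x t)) \<le> V (x 0)"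
    if x: "x \<in> sols" for x
  proof (rule nonneg_continuous_integral_halfline_le[OF cont[OF x]])
    fix t :: real assume t: "0 \<le> t"
    show "0 \<le> q (x t)" unfolding q[OF xc[OF x t]] using Q_nonneg[OF xc[OF x t]] g by simp
    \<comment> \<open>Discarding the nonnegative final value makes the bound on the cost independent
      of the horizon \<open>t\<close>.\<close>
    have "0 \<le> V (x t)"
      using ab(3)[OF xc[OF x t]] ab(1) scalar_prod_self_nonneg[of "x t"]
      by (meson mult_nonneg_nonneg less_imp_le order_trans)
    then show "integral {0..t} (\<lambda>s. q (x s)) \<le> V (x 0)" using diss[OF x, of 0 t] t by simp
  qed
  ultimately show ?thesis unfolding sols_def q_def g_def V_def by blast
qed

end
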